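(* Let $G$ be a graph with $m$ edges and $T$ triangles, received as a stream of edges, and let $\Delta_V$ (resp. $\Delta_E$) be the maximum number of triangles of $G$ sharing a common vertex (resp. a common edge). There is a single-pass sampling algorithm which takes as input $\epsilon>0$, $\delta\in(0,1)$ and a number $\widetilde{T}>0$ (and, following the standing convention below, the graph parameters it uses up to constant factors) with the following guarantee. If $\widetilde{T}\le T$, it outputs an estimate $\overline{T}$ with $|\overline{T}-T|\le \epsilon T$ with probability at least $1-\delta$, while keeping \[ O\!\left(\frac{m\log\frac{1}{\delta}}{\epsilon^2}\left(\frac{1}{\widetilde{T}^{2/3}}+\frac{\sqrt{\Delta_V}\log\widetilde{T}}{\widetilde{T}}+\frac{\Delta_E\log\widetilde{T}}{\widetilde{T}}\right)\right) \] edges (in expectation). If $\widetilde{T}>T$, then with probability at least $1-\delta$ the algorithm either determines that $\widetilde{T}>T$ or outputs a $(1\pm\epsilon)$-approximation to $T$.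
   Context: A triangle of $G$ is a set of three vertices pairwise joined by edges of $G$. In the (nonadaptive) sampling model, an algorithm chooses a distribution over sets $S$ of vertex pairs, independent of the input, and receives $E(G)\cap S$; it pays $\mathbb{E}|E(G)\cap S|$ samples (the number of kept edges). Standing convention of the paper: an algorithm whose sampling rates depend on a graph parameter (such as $\Delta_V$, $\Delta_E$, $\sum_v T_v^2$, $\sum_e T_e^2$) is assumed to know the value of that parameter up to constant factors. An $(\epsilon,\delta)$ approximation means an estimate within $(1\pm\epsilon)T$ with probability at least $1-\delta$.
   Formalization: In the bound on the number of kept edges, log T̃ is read as max(0, ln T̃), since for T̃ < 1 the literal bound can be negative and hence unattainable (e.g. a single triangle with T̃ = 0.1); for T̃ ≥ 1 nothing changes. Vertices are natural numbers. *)

theory Defs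
  imports "HOL-Probability.Probability"
begin

definition vertex_pairs :: "'v set \<Rightarrow> 'v set set" where
  "vertex_pairs V = {e. e \<subseteq> V \<and> card e = 2}"

definition simple_graph :: "'v set \<Rightarrow> 'v set set \<Rightarrow> bool" where
  "simple_graph V E \<longleftrightarrow> finite V \<and> E \<subseteq> vertex_pairs V"

definition triangles :: "'v set \<Rightarrow> 'v set set \<Rightarrow> 'v set set" where
  "triangles V E = {t. t \<subseteq> V \<and> card t = 3 \<and> (\<forall>u\<in>t. \<forall>v\<in>t. u \<noteq> v \<longrightarrow> {u, v} \<in> E)}"

definition num_triangles :: "'v set \<Rightarrow> 'v set set \<Rightarrow> nat" where
  "num_triangles V E = card (triangles V E)"

text \<open>The inserted 0 only matters for the graph without vertices, respectively without edges.\<close>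

definition max_vertex_triangles :: "'v set \<Rightarrow> 'v set set \<Rightarrow> nat" where
  "max_vertex_triangles V E = Max (insert 0 ((\<lambda>v. card {t \<in> triangles V E. v \<in> t}) ` V))"

definition max_edge_triangles :: "'v set \<Rightarrow> 'v set set \<Rightarrow> nat" where
  "max_edge_triangles V E = Max (insert 0 ((\<lambda>e. card {t \<in> triangles V E. e \<subseteq> t}) ` E))"

definition edge_stream :: "'v set set \<Rightarrow> 'v set list \<Rightarrow> bool" where
  "edge_stream E es \<longleftrightarrow> distinct es \<and> set es = E"

datatype verdict = Estimate real | Guess_Too_Large

text \<open>
  A nonadaptive sampling algorithm draws, before seeing the input, a set \<open>S\<close> of vertex pairs
  together with a decision rule \<open>f\<close> that is applied to the kept edges.
  Drawing \<open>S\<close> and \<open>f\<close> jointly lets the output depend on \<open>S\<close> and on all the internal randomness.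
\<close>

type_synonym 'v sampling_alg = "('v set set \<times> ('v set set \<Rightarrow> verdict)) pmf"

definition samples_pairs_of :: "'v set \<Rightarrow> 'v sampling_alg \<Rightarrow> bool" where
  "samples_pairs_of V A \<longleftrightarrow> (\<forall>(S, f) \<in> set_pmf A. S \<subseteq> vertex_pairs V)"

definition kept_edges :: "'v set set \<Rightarrow> 'v set list \<Rightarrow> 'v set set" where
  "kept_edges S es = fold (\<lambda>e K. if e \<in> S then insert e K else K) es {}"

lemma kept_edges_eq: "edge_stream E es \<Longrightarrow> kept_edges S es = E \<inter> S"
proof -
  have "fold (\<lambda>e K. if e \<in> S then insert e K else K) es K = K \<union> (set es \<inter> S)" for K
    by (induction es arbitrary: K) auto
  then show "edge_stream E es \<Longrightarrow> kept_edges S es = E \<inter> S"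
    by (simp add: kept_edges_def edge_stream_def)
qed

definition output_dist :: "'v sampling_alg \<Rightarrow> 'v set list \<Rightarrow> verdict pmf" where
  "output_dist A es = map_pmf (\<lambda>(S, f). f (kept_edges S es)) A"

definition expected_samples :: "'v sampling_alg \<Rightarrow> 'v set list \<Rightarrow> real" where
  "expected_samples A es = measure_pmf.expectation A (\<lambda>(S, f). real (card (kept_edges S es)))"

definition good_estimates :: "real \<Rightarrow> real \<Rightarrow> verdict set" where
  "good_estimates \<epsilon> T = {Estimate x | x. \<bar>x - T\<bar> \<le> \<epsilon> * T}"

definition known_within :: "real \<Rightarrow> real \<Rightarrow> real \<Rightarrow> bool" where
  "known_within c x y \<longleftrightarrow> x / c \<le> y \<and> y \<le> c * x"

text \<open>
  The logarithm of the guess is cut off at 0: for a guess below 1 the plain logarithm is negative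
  and would make the bound on the (nonnegative) number of samples negative.
\<close>

definition log_plus :: "real \<Rightarrow> real" where
  "log_plus x = max 0 (ln x)"

definition sample_bound :: "real \<Rightarrow> real \<Rightarrow> real \<Rightarrow> real \<Rightarrow> real \<Rightarrow> real \<Rightarrow> real" where
  "sample_bound m \<epsilon> \<delta> T' \<Delta>V \<Delta>E =
     m * ln (1 / \<delta>) / \<epsilon>\<^sup>2 *
       (1 / T' powr (2 / 3) + sqrt \<Delta>V * log_plus T' / T' + \<Delta>E * log_plus T' / T')"

end

theory Submission
  imports Defs
begin

text \<open>
  Colour the vertices uniformly with \<open>N\<close> colours and keep an edge if both of its ends have the same
  colour among the first \<open>n\<close> ones. This samples vertices at rate \<open>n / N\<close> and colours the sampled ones
  with \<open>n\<close> colours. An edge is kept with probability \<open>n / N^2\<close>, a triangle with probability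
  \<open>\<rho> = n / N^3\<close>, and two triangles sharing an edge or a vertex both survive with probability
  \<open>n / N^4\<close> or \<open>n / N^5\<close>. Hence the number of kept triangles divided by \<open>\<rho>\<close> is an unbiased estimate of \<open>T\<close>
  with variance at most \<open>T N^3 / n + 3 T \<Delta>\<^sub>E N^2 / n + 3 T \<Delta>\<^sub>V (N / n - 1)\<close>.
  With \<open>a\<close> of order \<open>1 / (\<epsilon>^2 T')\<close>, the colour count \<open>N = max(a^(-1/3), \<surd>\<Delta>\<^sub>V)\<close> (cut off at \<open>1 / (a \<Delta>\<^sub>E)\<close>)
  and the least \<open>n\<close> making each of these terms \<open>O(T / a)\<close> give the edge rate
  \<open>O(a^(2/3) + a \<surd>\<Delta>\<^sub>V + a \<Delta>\<^sub>E)\<close>; if \<open>a \<Delta>\<^sub>V \<ge> 1\<close>, one takes \<open>n = N = min(a^(-1/2), 1 / (a \<Delta>\<^sub>E))\<close>.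
  Chebyshev's inequality and a median of \<open>O(log (1 / \<delta>))\<close> independent copies bound the error by
  \<open>\<epsilon>/4 * max(T, T')\<close>. The guess is rejected if the median is below \<open>(1 - \<epsilon>/4) T'\<close>; otherwise \<open>T\<close> is at least
  \<open>T' / 2\<close>, so that the error is small relative to \<open>T\<close>.
\<close>

section \<open>Random vertex colourings\<close>

definition vertex_colouring :: "'v set \<Rightarrow> nat \<Rightarrow> ('v \<Rightarrow> nat) pmf" where
  "vertex_colouring V N = Pi_pmf V 0 (\<lambda>_. pmf_of_set {..<N})"

text \<open>A colour \<open>c \<ge> n\<close> means that the vertex is discarded, so a single
  colouring encodes both the vertex sampling and the colouring of the sampled vertices.\<close>

definition monochromatic :: "nat \<Rightarrow> ('v \<Rightarrow> nat) \<Rightarrow> 'v set \<Rightarrow> bool" where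
  "monochromatic n f A \<longleftrightarrow> (\<exists>c<n. \<forall>v\<in>A. f v = c)"

lemma finite_set_pmf_Pi_pmf:
  assumes "finite A" "\<And>x. x \<in> A \<Longrightarrow> finite (set_pmf (p x))"
  shows "finite (set_pmf (Pi_pmf A d p))"
  using assms by (simp add: set_Pi_pmf finite_PiE_dflt)

lemma finite_set_pmf_vertex_colouring:
  assumes "finite V" "N > 0"
  shows "finite (set_pmf (vertex_colouring V N))"
proof -
  have "{..<N} \<noteq> {}" using assms by auto
  then show ?thesis
    unfolding vertex_colouring_def using assms by (intro finite_set_pmf_Pi_pmf) (auto simp: set_pmf_of_set)
qed

lemma integrable_vertex_colouring:
  fixes g :: "('v \<Rightarrow> nat) \<Rightarrow> real"
  assumes "finite V" "N > 0"
  shows "integrable (vertex_colouring V N) g"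
  by (intro integrable_measure_pmf_finite finite_set_pmf_vertex_colouring assms)

text \<open>The event is a product over the vertices: a singleton at each vertex of
  \<open>B\<close>, no constraint elsewhere. Independence then multiplies the factors
  \<open>1 / N\<close>.\<close>

lemma prob_vertex_colouring_agrees:
  assumes "finite V" "B \<subseteq> V" "\<And>v. v \<in> B \<Longrightarrow> g v < N"
  shows "measure_pmf.prob (vertex_colouring V N) {f. \<forall>v\<in>B. f v = g v} = 1 / real N ^ card B"
proof (cases "B = {}")
  case False
  then have ne: "{..<N} \<noteq> {}" using assms(3) by fastforce
  have "{f. \<forall>v\<in>B. f v = g v} = Pi V (\<lambda>v. if v \<in> B then {g v} else UNIV)"
    using assms(2) by (auto simp: Pi_def split: if_splits)
  then have "measure_pmf.prob (vertex_colouring V N) {f. \<forall>v\<in>B. f v = g v} =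
      (\<Prod>v\<in>V. measure_pmf.prob (pmf_of_set {..<N}) (if v \<in> B then {g v} else UNIV))"
    unfolding vertex_colouring_def using assms(1) by (simp add: measure_Pi_pmf_Pi)
  also have "\<dots> = (\<Prod>v\<in>V. if v \<in> B then 1 / real N else 1)"
    using ne assms(3) by (intro prod.cong) (auto simp: measure_pmf_single)
  also have "\<dots> = (1 / real N) ^ card B"
    using assms(1,2) by (simp add: prod.If_cases Int_absorb1)
  finally show ?thesis by (simp add: power_one_over)
qed simp

text \<open>The events "all of \<open>A\<close> has colour \<open>c\<close>" are disjoint for
  different \<open>c\<close> because \<open>A\<close> has an element; the empty set would be counted
  \<open>n\<close> times.\<close>

lemma of_bool_monochromatic:
  assumes "A \<noteq> {}"
  shows "of_bool (monochromatic n f A) = (\<Sum>c<n. indicator {f. \<forall>v\<in>A. f v = c} f :: real)"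
proof -
  obtain a where a: "a \<in> A" using assms by auto
  have "(\<Sum>c<n. indicator {f. \<forall>v\<in>A. f v = c} f :: real) =
     (\<Sum>c<n. if c = f a then of_bool (\<forall>v\<in>A. f v = f a) else 0)"
    by (intro sum.cong refl) (use a in \<open>force simp: indicator_def\<close>)
  also have "\<dots> = of_bool (monochromatic n f A)"
    using a by (auto simp: monochromatic_def)
  finally show ?thesis by simp
qed

lemma expectation_monochromatic:
  assumes "finite V" "A \<subseteq> V" "A \<noteq> {}" "0 < N" "n \<le> N"
  shows "measure_pmf.expectation (vertex_colouring V N) (\<lambda>f. of_bool (monochromatic n f A))
    = real n / real N ^ card A"
proof -
  have "measure_pmf.expectation (vertex_colouring V N) (\<lambda>f. of_bool (monochromatic n f A))
     = (\<Sum>c<n. measure_pmf.prob (vertex_colouring V N) {f. \<forall>v\<in>A. f v = c})"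
    unfolding of_bool_monochromatic[OF assms(3)]
    by (subst Bochner_Integration.integral_sum) (auto intro!: integrable_vertex_colouring assms)
  also have "\<dots> = (\<Sum>c<n. 1 / real N ^ card A)"
    by (intro sum.cong prob_vertex_colouring_agrees assms refl) (use assms in auto)
  finally show ?thesis by simp
qed

text \<open>For fixed colours \<open>c\<close> and \<open>d\<close> the joint event prescribes one
  function on \<open>A \<union> B\<close>, whose size is additive. Vertex-disjoint triangles are
  therefore uncorrelated.\<close>

lemma expectation_monochromatic_disjoint:
  assumes "finite V" "A \<subseteq> V" "A \<noteq> {}" "B \<subseteq> V" "B \<noteq> {}" "A \<inter> B = {}" "0 < N" "n \<le> N"
  shows "measure_pmf.expectation (vertex_colouring V N)
      (\<lambda>f. of_bool (monochromatic n f A) * of_bool (monochromatic n f B))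
    = (real n / real N ^ card A) * (real n / real N ^ card B)"
proof -
  have *: "indicator {f. \<forall>v\<in>A. f v = c} f * indicator {f. \<forall>v\<in>B. f v = d} f =
     (indicator {f. \<forall>v\<in>A \<union> B. f v = (if v \<in> A then c else d)} f :: real)" for c d and f :: "_ \<Rightarrow> nat"
  proof -
    have "(\<forall>v\<in>A \<union> B. f v = (if v \<in> A then c else d)) \<longleftrightarrow> (\<forall>v\<in>A. f v = c) \<and> (\<forall>v\<in>B. f v = d)"
      using assms(6) by auto
    then show ?thesis by (auto simp: indicator_def)
  qed
  have card: "card (A \<union> B) = card A + card B"
    using assms by (intro card_Un_disjoint finite_subset[OF _ assms(1)]) auto
  have "measure_pmf.expectation (vertex_colouring V N)
      (\<lambda>f. of_bool (monochromatic n f A) * of_bool (monochromatic n f B))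
     = (\<Sum>c<n. \<Sum>d<n. measure_pmf.prob (vertex_colouring V N)
           {f. \<forall>v\<in>A \<union> B. f v = (if v \<in> A then c else d)})"
    unfolding of_bool_monochromatic[OF assms(3)] of_bool_monochromatic[OF assms(5)] sum_product *
    by (simp add: Bochner_Integration.integral_sum integrable_vertex_colouring assms
           del: Un_iff ball_Un)
  also have "\<dots> = (\<Sum>c<n. \<Sum>d<n. 1 / real N ^ card (A \<union> B))"
    by (intro sum.cong prob_vertex_colouring_agrees assms refl) (use assms in auto)
  finally show ?thesis by (simp add: card power_add)
qed

lemma monochromatic_Un:
  assumes "A \<inter> B \<noteq> {}"
  shows "monochromatic n f (A \<union> B) \<longleftrightarrow> monochromatic n f A \<and> monochromatic n f B"
  using assms unfolding monochromatic_def by (metis Int_iff Un_iff ex_in_conv)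

lemma expectation_monochromatic_overlap:
  assumes "finite V" "A \<subseteq> V" "B \<subseteq> V" "A \<inter> B \<noteq> {}" "0 < N" "n \<le> N"
  shows "measure_pmf.expectation (vertex_colouring V N)
      (\<lambda>f. of_bool (monochromatic n f A) * of_bool (monochromatic n f B))
    = real n / real N ^ card (A \<union> B)"
proof -
  have "(\<lambda>f. of_bool (monochromatic n f A) * of_bool (monochromatic n f B)) =
        (\<lambda>f. of_bool (monochromatic n f (A \<union> B)) :: real)"
    using monochromatic_Un[OF assms(4)] by (auto simp: fun_eq_iff)
  then show ?thesis using expectation_monochromatic[of V "A \<union> B" N n] assms by auto
qed

section \<open>The variance of the number of kept triangles\<close>

definition coloured_pairs :: "'v set \<Rightarrow> nat \<Rightarrow> ('v \<Rightarrow> nat) \<Rightarrow> 'v set set" where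
  "coloured_pairs V n f = {e \<in> vertex_pairs V. monochromatic n f e}"

text \<open>The three edges of a surviving triangle might a priori have different colours, but they
  meet pairwise: fixing a vertex \<open>u\<close>, the edge from \<open>u\<close> to any other
  vertex transports the colour of \<open>u\<close>.\<close>

lemma triangles_kept:
  assumes "E \<subseteq> vertex_pairs V"
  shows "triangles V (E \<inter> coloured_pairs V n f) = {t \<in> triangles V E. monochromatic n f t}"
proof (intro equalityI subsetI)
  fix t assume t: "t \<in> triangles V (E \<inter> coloured_pairs V n f)"
  then have tri: "t \<in> triangles V E" and c3: "card t = 3" by (auto simp: triangles_def)
  obtain u where u: "u \<in> t" using c3 by fastforce
  have m: "monochromatic n f {x, y}" if "x \<in> t" "y \<in> t" "x \<noteq> y" for x y
    using t that by (auto simp: triangles_def coloured_pairs_def)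
  \<comment> \<open>A second vertex provides an actual kept edge at \<open>u\<close>, which shows
    that the colour of \<open>u\<close> is below \<open>n\<close>.\<close>
  have "t \<noteq> {u}" using c3 by auto
  then obtain w where w: "w \<in> t" "w \<noteq> u" using u by auto
  have "f u < n" using m[of u w] u w by (auto simp: monochromatic_def)
  moreover have "f x = f u" if "x \<in> t" for x
    using m[of u x] u that by (cases "x = u") (auto simp: monochromatic_def)
  ultimately show "t \<in> {t \<in> triangles V E. monochromatic n f t}"
    using tri by (auto simp: monochromatic_def)
next
  fix t assume "t \<in> {t \<in> triangles V E. monochromatic n f t}"
  then have t: "t \<in> triangles V E" and m: "monochromatic n f t" by auto
  have "{u, v} \<in> E \<inter> coloured_pairs V n f" if "u \<in> t" "v \<in> t" "u \<noteq> v" for u v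
  proof -
    have "{u, v} \<in> E" using t that by (auto simp: triangles_def)
    moreover have "monochromatic n f {u, v}" using m that by (auto simp: monochromatic_def)
    ultimately show ?thesis using assms by (auto simp: coloured_pairs_def)
  qed
  then show "t \<in> triangles V (E \<inter> coloured_pairs V n f)"
    using t by (auto simp: triangles_def)
qed

lemma finite_edges:
  assumes "finite V" "E \<subseteq> vertex_pairs V"
  shows "finite E"
  by (rule finite_subset[of _ "Pow V"]) (use assms in \<open>auto simp: vertex_pairs_def\<close>)

lemma finite_triangles: "finite V \<Longrightarrow> finite (triangles V E)"
  by (rule finite_subset[of _ "Pow V"]) (auto simp: triangles_def)

lemma card_triangles_at_vertex_le:
  assumes "finite V" "v \<in> V"
  shows "card {t \<in> triangles V E. v \<in> t} \<le> max_vertex_triangles V E"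
  unfolding max_vertex_triangles_def using assms by (intro Max_ge) auto

lemma card_triangles_at_edge_le:
  assumes "finite E" "e \<in> E"
  shows "card {t \<in> triangles V E. e \<subseteq> t} \<le> max_edge_triangles V E"
  unfolding max_edge_triangles_def using assms by (intro Max_ge) auto

text \<open>
  The three terms account for \<open>s = t\<close>, for a shared edge and for a shared vertex; the last one
  vanishes when all colours are kept (\<open>n = N\<close>).
\<close>

lemma monochromatic_triangle_covariance_le:
  fixes V :: "'v set"
  assumes V: "finite V" and t: "t \<in> triangles V E" and s: "s \<in> triangles V E"
    and n: "0 < n" "n \<le> N"
  defines "\<rho> \<equiv> real n / real N ^ 3"
  shows "measure_pmf.expectation (vertex_colouring V N)
      (\<lambda>f. of_bool (monochromatic n f t) * of_bool (monochromatic n f s)) - \<rho>\<^sup>2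
    \<le> of_bool (s = t) * \<rho> + (\<Sum>e | e \<subseteq> t \<and> card e = 2. of_bool (e \<subseteq> s)) * (\<rho> / N)
      + (\<Sum>v\<in>t. of_bool (v \<in> s)) * (\<rho>\<^sup>2 * (real N / real n - 1))"
    (is "?E - _ \<le> ?R1 + ?R2 + ?R3")
proof -
  have sub: "t \<subseteq> V" "s \<subseteq> V" and c: "card t = 3" "card s = 3" using t s by (auto simp: triangles_def)
  have fin: "finite t" "finite s" using sub V finite_subset by auto
  have ne: "t \<noteq> {}" "s \<noteq> {}" using c by auto
  have N: "N > 0" using n by simp
  have \<rho>: "\<rho> > 0" using n N by (simp add: \<rho>_def)
  have fac: "real N / real n - 1 \<ge> 0" using n by (simp add: field_simps)
  have nonneg: "?R1 \<ge> 0" "?R2 \<ge> 0" "?R3 \<ge> 0" using \<rho> fac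
    by (auto intro!: mult_nonneg_nonneg divide_nonneg_nonneg sum_nonneg simp del: times_divide_eq_right)
  \<comment> \<open>The size of the intersection determines the exponent of \<open>N\<close> in
    \<open>?E\<close>: sizes 1, 2, 3 give exponents 5, 4, 3.\<close>
  have cu: "card (t \<union> s) + card (t \<inter> s) = 6" using card_Un_Int[OF fin] c by simp
  have EI: "?E = real n / real N ^ card (t \<union> s)" if "t \<inter> s \<noteq> {}"
    using expectation_monochromatic_overlap[of V t s N n] sub V that n N by auto
  have "card (t \<inter> s) \<le> 3" using card_mono[of t "t \<inter> s"] fin c by auto
  then consider "card (t \<inter> s) = 0" | "card (t \<inter> s) = 1" | "card (t \<inter> s) = 2" | "card (t \<inter> s) = 3"
    by linarith
  then show ?thesis
  proof cases
    case 1
    then have "t \<inter> s = {}" using fin by auto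
    then have "?E = \<rho>\<^sup>2"
      using expectation_monochromatic_disjoint[of V t s N n] V sub ne n N c
      by (simp add: \<rho>_def power2_eq_square)
    then show ?thesis using nonneg by linarith
  next
    case 2
    then obtain v where v: "t \<inter> s = {v}" by (auto simp: card_1_singleton_iff)
    have "t \<inter> {x. x \<in> s} = {v}" using v by auto
    then have "(\<Sum>v\<in>t. of_bool (v \<in> s) :: real) = 1" using fin v by simp
    \<comment> \<open>Here \<open>n / N^5\<close> exceeds the product \<open>\<rho>\<^sup>2\<close>
      of the means by the factor \<open>N / n\<close>, which leaves a covariance proportional to
      \<open>N / n - 1\<close>.\<close>
    moreover have "?E = \<rho>\<^sup>2 * (real N / real n)"
    proof -
      have "t \<inter> s \<noteq> {}" "card (t \<union> s) = 5" using v 2 cu by auto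
      then show ?thesis using EI n N by (simp add: \<rho>_def power2_eq_square field_simps eval_nat_numeral)
    qed
    ultimately show ?thesis using nonneg by (simp add: algebra_simps)
  next
    case 3
    \<comment> \<open>The shared pair \<open>t \<inter> s\<close> is itself one of the
      summands.\<close>
    have "of_bool (t \<inter> s \<subseteq> s) \<le> (\<Sum>e | e \<subseteq> t \<and> card e = 2. of_bool (e \<subseteq> s) :: real)"
      by (rule member_le_sum) (use 3 fin in auto)
    then have "?R2 \<ge> \<rho> / N" using \<rho> N by (simp add: field_simps)
    moreover have "?E = \<rho> / N"
    proof -
      have "t \<inter> s \<noteq> {}" "card (t \<union> s) = 4" using 3 cu by auto
      then show ?thesis using EI by (simp add: \<rho>_def eval_nat_numeral)
    qed
    ultimately show ?thesis using nonneg zero_le_power2[of \<rho>] by linarith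
  next
    case 4
    have "t \<inter> s = t" "t \<inter> s = s" 
      using 4 c card_subset_eq[OF fin(1), of "t \<inter> s"] card_subset_eq[OF fin(2), of "t \<inter> s"]
      by (metis Int_lower1 Int_lower2)+
    then have "s = t" by auto
    then have "?E = \<rho>" using EI ne c by (simp add: \<rho>_def)
    moreover have "?R1 = \<rho>" using \<open>s = t\<close> by simp
    ultimately show ?thesis using nonneg zero_le_power2[of \<rho>] by linarith
  qed
qed

lemma num_triangles_kept:
  assumes "finite V" "E \<subseteq> vertex_pairs V"
  shows "real (num_triangles V (E \<inter> coloured_pairs V n f)) =
    (\<Sum>t\<in>triangles V E. of_bool (monochromatic n f t))"
proof -
  have "triangles V E \<inter> {t. monochromatic n f t} = {t \<in> triangles V E. monochromatic n f t}" by auto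
  then show ?thesis
    using finite_triangles[OF assms(1), of E]
    by (simp add: num_triangles_def triangles_kept[OF assms(2)])
qed

text \<open>The square is expanded over ordered pairs \<open>(t, s)\<close> of triangles, and each
  pair is charged to the edges and vertices of \<open>t\<close> lying in \<open>s\<close>. A
  triangle has three of each, and each edge or vertex is charged at most as often as the respective
  maximum allows.\<close>

lemma triangle_count_variance_le:
  fixes V :: "'v set"
  assumes V: "finite V" and E: "E \<subseteq> vertex_pairs V" and n: "0 < n" "n \<le> N"
  defines "\<rho> \<equiv> real n / real N ^ 3" and "T \<equiv> real (num_triangles V E)"
  shows "measure_pmf.expectation (vertex_colouring V N)
      (\<lambda>f. (real (num_triangles V (E \<inter> coloured_pairs V n f)) - T * \<rho>)\<^sup>2)
    \<le> T * (\<rho> + 3 * max_edge_triangles V E * (\<rho> / N)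
        + 3 * max_vertex_triangles V E * (\<rho>\<^sup>2 * (real N / real n - 1)))"
proof -
  let ?P = "vertex_colouring V N"
  let ?Tr = "triangles V E"
  let ?Z = "\<lambda>f t. of_bool (monochromatic n f t) :: real"
  have N: "N > 0" using n by simp
  note finE = finite_edges[OF V E]
  note fin = finite_triangles[OF V, of E]
  note int [simp] = integrable_vertex_colouring[OF V N]
  have fac: "real N / real n - 1 \<ge> 0" using n by (simp add: field_simps)
  have \<rho>: "\<rho> > 0" using n N by (simp add: \<rho>_def)
  have tri: "t \<subseteq> V \<and> t \<noteq> {} \<and> card t = 3" if "t \<in> ?Tr" for t
    using that by (auto simp: triangles_def)
  have EZ: "measure_pmf.expectation ?P (\<lambda>f. ?Z f t) = \<rho>" if "t \<in> ?Tr" for t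
    using expectation_monochromatic[of V t N n] tri[OF that] V N n by (simp add: \<rho>_def)
  have T: "T = real (card ?Tr)" by (simp add: T_def num_triangles_def)
  have "(\<Sum>t\<in>?Tr. ?Z f t) - T * \<rho> = (\<Sum>t\<in>?Tr. ?Z f t - \<rho>)" for f
    by (simp add: T sum_subtractf)
  then have "measure_pmf.expectation ?P (\<lambda>f. (real (num_triangles V (E \<inter> coloured_pairs V n f)) - T * \<rho>)\<^sup>2)
    = measure_pmf.expectation ?P (\<lambda>f. \<Sum>t\<in>?Tr. \<Sum>s\<in>?Tr. ?Z f t * ?Z f s - \<rho> * ?Z f t - \<rho> * ?Z f s + \<rho>\<^sup>2)"
    by (simp add: num_triangles_kept[OF V E] power2_eq_square sum_product algebra_simps)
  also have "\<dots> = (\<Sum>t\<in>?Tr. \<Sum>s\<in>?Tr. measure_pmf.expectation ?P (\<lambda>f. ?Z f t * ?Z f s - \<rho> * ?Z f t - \<rho> * ?Z f s + \<rho>\<^sup>2))"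
    by (simp only: Bochner_Integration.integral_sum int)
  also have "\<dots> = (\<Sum>t\<in>?Tr. \<Sum>s\<in>?Tr. measure_pmf.expectation ?P (\<lambda>f. ?Z f t * ?Z f s) - \<rho>\<^sup>2)"
  proof (intro sum.cong refl)
    fix t s assume ts: "t \<in> ?Tr" "s \<in> ?Tr"
    have "measure_pmf.expectation ?P (\<lambda>f. ?Z f t * ?Z f s - \<rho> * ?Z f t - \<rho> * ?Z f s + \<rho>\<^sup>2)
      = measure_pmf.expectation ?P (\<lambda>f. ?Z f t * ?Z f s) - \<rho> * measure_pmf.expectation ?P (\<lambda>f. ?Z f t)
        - \<rho> * measure_pmf.expectation ?P (\<lambda>f. ?Z f s) + \<rho>\<^sup>2"
      by (simp del: of_bool_conj)
    then show "measure_pmf.expectation ?P (\<lambda>f. ?Z f t * ?Z f s - \<rho> * ?Z f t - \<rho> * ?Z f s + \<rho>\<^sup>2)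
      = measure_pmf.expectation ?P (\<lambda>f. ?Z f t * ?Z f s) - \<rho>\<^sup>2"
      using ts by (simp add: EZ power2_eq_square)
  qed
  also have "\<dots> \<le> (\<Sum>t\<in>?Tr. \<Sum>s\<in>?Tr. of_bool (s = t) * \<rho> +
       (\<Sum>e | e \<subseteq> t \<and> card e = 2. of_bool (e \<subseteq> s)) * (\<rho> / N)
      + (\<Sum>v\<in>t. of_bool (v \<in> s)) * (\<rho>\<^sup>2 * (real N / real n - 1)))"
    by (intro sum_mono) (unfold \<rho>_def, intro monochromatic_triangle_covariance_le V n, auto)
  also have "\<dots> \<le> (\<Sum>t\<in>?Tr. \<rho> + 3 * max_edge_triangles V E * (\<rho> / N)
        + 3 * max_vertex_triangles V E * (\<rho>\<^sup>2 * (real N / real n - 1)))"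
  proof (intro sum_mono)
    fix t assume t: "t \<in> ?Tr"
    note tt = tri[OF t]
    have fint: "finite t" using tt V finite_subset by blast
    have "(\<Sum>s\<in>?Tr. of_bool (s = t)) = (1::real)"
    proof -
      have "?Tr \<inter> {s. s = t} = {t}" using t by auto
      then show ?thesis using fin by simp
    qed
    then have 1: "(\<Sum>s\<in>?Tr. of_bool (s = t) * \<rho>) = \<rho>"
      unfolding sum_distrib_right[symmetric] by simp
    \<comment> \<open>Exchanging the sums counts, for each of the three edges of \<open>t\<close>,
      the triangles through it.\<close>
    have "(\<Sum>s\<in>?Tr. \<Sum>e | e \<subseteq> t \<and> card e = 2. of_bool (e \<subseteq> s) :: real)
      = (\<Sum>e | e \<subseteq> t \<and> card e = 2. real (card {s \<in> ?Tr. e \<subseteq> s}))"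
      using fin by (subst sum.swap) (simp add: Int_def)
    also have "\<dots> \<le> (\<Sum>e | e \<subseteq> t \<and> card e = 2. real (max_edge_triangles V E))"
    proof (intro sum_mono)
      fix e assume "e \<in> {e. e \<subseteq> t \<and> card e = 2}"
      then have "e \<in> E" using t by (auto simp: triangles_def card_2_iff)
      then show "real (card {s \<in> ?Tr. e \<subseteq> s}) \<le> real (max_edge_triangles V E)"
        using card_triangles_at_edge_le[OF finE] by simp
    qed
    also have "\<dots> = 3 * real (max_edge_triangles V E)"
      using n_subsets[OF fint, of 2] tt by (simp add: choose_two)
    finally have 2: "(\<Sum>s\<in>?Tr. (\<Sum>e | e \<subseteq> t \<and> card e = 2. of_bool (e \<subseteq> s)) * (\<rho> / N))
        \<le> 3 * max_edge_triangles V E * (\<rho> / N)"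
      unfolding sum_distrib_right[symmetric] using \<rho> by (intro mult_right_mono) auto
    have "(\<Sum>s\<in>?Tr. \<Sum>v\<in>t. of_bool (v \<in> s) :: real) = (\<Sum>v\<in>t. real (card {s \<in> ?Tr. v \<in> s}))"
      using fin by (subst sum.swap) (simp add: Int_def)
    also have "\<dots> \<le> (\<Sum>v\<in>t. real (max_vertex_triangles V E))"
      using card_triangles_at_vertex_le[OF V, of _ E] tt by (intro sum_mono) auto
    also have "\<dots> = 3 * real (max_vertex_triangles V E)" using tt by simp
    finally have 3: "(\<Sum>s\<in>?Tr. (\<Sum>v\<in>t. of_bool (v \<in> s)) * (\<rho>\<^sup>2 * (real N / real n - 1)))
        \<le> 3 * max_vertex_triangles V E * (\<rho>\<^sup>2 * (real N / real n - 1))"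
      unfolding sum_distrib_right[symmetric] using fac by (intro mult_right_mono) auto
    show "(\<Sum>s\<in>?Tr. of_bool (s = t) * \<rho> +
       (\<Sum>e | e \<subseteq> t \<and> card e = 2. of_bool (e \<subseteq> s)) * (\<rho> / N)
      + (\<Sum>v\<in>t. of_bool (v \<in> s)) * (\<rho>\<^sup>2 * (real N / real n - 1))) \<le> \<rho> + 3 * max_edge_triangles V E * (\<rho> / N)
        + 3 * max_vertex_triangles V E * (\<rho>\<^sup>2 * (real N / real n - 1))"
      unfolding sum.distrib using 1 2 3 by linarith
  qed
  also have "\<dots> = T * (\<rho> + 3 * max_edge_triangles V E * (\<rho> / N)
        + 3 * max_vertex_triangles V E * (\<rho>\<^sup>2 * (real N / real n - 1)))"
    by (simp add: T)
  finally show ?thesis .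
qed

lemma expectation_card_kept_edges:
  assumes V: "finite V" and E: "E \<subseteq> vertex_pairs V" and n: "0 < N" "n \<le> N"
  shows "measure_pmf.expectation (vertex_colouring V N) (\<lambda>f. real (card (E \<inter> coloured_pairs V n f)))
    = real (card E) * (real n / real N ^ 2)"
proof -
  note finE = finite_edges[OF V E]
  have "E \<inter> coloured_pairs V n f = {e \<in> E. monochromatic n f e}" for f
    using E by (auto simp: coloured_pairs_def)
  then have "real (card (E \<inter> coloured_pairs V n f)) = (\<Sum>e\<in>E. of_bool (monochromatic n f e))" for f
    using finE by (simp add: Int_def)
  then have "measure_pmf.expectation (vertex_colouring V N) (\<lambda>f. real (card (E \<inter> coloured_pairs V n f)))
    = (\<Sum>e\<in>E. measure_pmf.expectation (vertex_colouring V N) (\<lambda>f. of_bool (monochromatic n f e)))"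
    by (simp add: Bochner_Integration.integral_sum integrable_vertex_colouring[OF V n(1)])
  also have "\<dots> = (\<Sum>e\<in>E. real n / real N ^ 2)"
  proof (intro sum.cong refl)
    fix e assume "e \<in> E"
    then have "e \<subseteq> V" "card e = 2" "e \<noteq> {}" using E by (auto simp: vertex_pairs_def)
    then show "measure_pmf.expectation (vertex_colouring V N) (\<lambda>f. of_bool (monochromatic n f e))
        = real n / real N ^ 2"
      using expectation_monochromatic[of V e N n] V n by simp
  qed
  finally show ?thesis by simp
qed

text \<open>
  For bounds \<open>U\<close> and \<open>W\<close> on the triangles at a vertex and at an edge, each of the three
  inequalities bounds one term of the variance by a multiple of \<open>T / a\<close>; the term controlled by the
  last one is zero for \<open>n = N\<close>, and the whole variance is zero for \<open>N = 1\<close>.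
\<close>

definition admissible_rates :: "real \<Rightarrow> real \<Rightarrow> real \<Rightarrow> nat \<Rightarrow> nat \<Rightarrow> bool" where
  "admissible_rates a U W n N \<longleftrightarrow> 0 < n \<and> n \<le> N \<and>
     (N = 1 \<or> a * real N ^ 3 \<le> real n \<and> a * W * real N ^ 2 \<le> real n \<and>
        (n = N \<or> a * U * real N \<le> real n))"

text \<open>Chebyshev's inequality: the estimate has variance at most \<open>7 * T / a\<close>, and
  \<open>112 = 7 * 16\<close> yields failure probability \<open>1 / 16\<close>.\<close>

lemma triangle_estimate_concentrated:
  fixes V :: "'v set"
  assumes V: "finite V" and E: "E \<subseteq> vertex_pairs V" and rates: "admissible_rates a U W n N"
    and a: "a > 0" and U: "real (max_vertex_triangles V E) \<le> U" and W: "real (max_edge_triangles V E) \<le> W"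
    and d: "d > 0" "112 * real (num_triangles V E) \<le> a * d\<^sup>2"
  shows "measure_pmf.prob (vertex_colouring V N)
     {f. d < \<bar>real (num_triangles V (E \<inter> coloured_pairs V n f)) / (real n / real N ^ 3) - real (num_triangles V E)\<bar>}
     \<le> 1 / 16"
proof -
  let ?P = "vertex_colouring V N"
  define \<rho> where "\<rho> = real n / real N ^ 3"
  define T where "T = real (num_triangles V E)"
  let ?X = "\<lambda>f. real (num_triangles V (E \<inter> coloured_pairs V n f))"
  have n: "0 < n" "n \<le> N" and N: "N > 0" using rates by (auto simp: admissible_rates_def)
  have \<rho>: "\<rho> > 0" using n N by (simp add: \<rho>_def)
  have T0: "T \<ge> 0" by (simp add: T_def)
  \<comment> \<open>The 7 is \<open>1 + 3 + 3\<close>, from the three terms of the variance bound,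
    each unit contributing at most \<open>\<rho>\<^sup>2 / a\<close>.\<close>
  have var: "measure_pmf.expectation ?P (\<lambda>f. (?X f - T * \<rho>)\<^sup>2) \<le> T * 7 / a * \<rho>\<^sup>2"
  proof (cases "N = 1")
    case True
    \<comment> \<open>With one colour every triangle survives and the estimate is exact.\<close>
    have "AE f in ?P. ?X f = T"
    proof (subst AE_measure_pmf_iff, intro ballI)
      fix f assume "f \<in> set_pmf ?P"
      then have "f v = 0" if "v \<in> V" for v
        using V True that by (auto simp: vertex_colouring_def set_Pi_pmf PiE_dflt_def lessThan_Suc)
      then have "monochromatic n f t" if "t \<in> triangles V E" for t
        using that n by (auto simp: monochromatic_def triangles_def)
      then show "?X f = T" using num_triangles_kept[OF V E, of n f] by (simp add: T_def num_triangles_def)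
    qed
    moreover have "\<rho> = 1" using True n by (simp add: \<rho>_def)
    ultimately have "measure_pmf.expectation ?P (\<lambda>f. (?X f - T * \<rho>)\<^sup>2) = 0"
      by (intro integral_eq_zero_AE) auto
    then show ?thesis using T0 a by simp
  next
    case False
    then have c: "a * real N ^ 3 \<le> real n" "a * W * real N ^ 2 \<le> real n" "n = N \<or> a * U * real N \<le> real n"
      using rates by (auto simp: admissible_rates_def)
    have 1: "\<rho> \<le> \<rho>\<^sup>2 / a"
    proof -
      have "a \<le> \<rho>" using c(1) N by (simp add: \<rho>_def field_simps)
      then have "a * \<rho> \<le> \<rho> * \<rho>" using \<rho> by (intro mult_right_mono) auto
      then show ?thesis using a by (simp add: field_simps power2_eq_square)
    qed
    have 2: "max_edge_triangles V E * (\<rho> / N) \<le> \<rho>\<^sup>2 / a"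
    proof -
      have "a * max_edge_triangles V E * real N ^ 2 \<le> a * W * real N ^ 2"
        using W a by (intro mult_right_mono mult_left_mono) auto
      then have "a * max_edge_triangles V E * real N ^ 2 \<le> real n" using c(2) by linarith
      then have "a * max_edge_triangles V E / N \<le> \<rho>" using N by (simp add: \<rho>_def field_simps eval_nat_numeral)
      then have "a * max_edge_triangles V E / N * \<rho> \<le> \<rho> * \<rho>" using \<rho> by (intro mult_right_mono) auto
      then show ?thesis using a N by (simp add: field_simps power2_eq_square)
    qed
    have 3: "max_vertex_triangles V E * (\<rho>\<^sup>2 * (real N / real n - 1)) \<le> \<rho>\<^sup>2 / a"
      using c(3)
    proof
      assume "n = N" then show ?thesis using a n by simp
    next
      assume *: "a * U * real N \<le> real n"
      have "a * max_vertex_triangles V E * real N \<le> a * U * real N"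
        using U a by (intro mult_right_mono mult_left_mono) auto
      then have "a * max_vertex_triangles V E * real N \<le> real n" using * by linarith
      then have "max_vertex_triangles V E * (real N / real n) \<le> 1 / a"
        using a n by (simp add: field_simps)
      then have "max_vertex_triangles V E * (real N / real n - 1) \<le> 1 / a" 
        by (simp add: right_diff_distrib)
      then have "\<rho>\<^sup>2 * (max_vertex_triangles V E * (real N / real n - 1)) \<le> \<rho>\<^sup>2 * (1 / a)"
        by (intro mult_left_mono) auto
      then show ?thesis by (simp add: algebra_simps)
    qed
    have "measure_pmf.expectation ?P (\<lambda>f. (?X f - T * \<rho>)\<^sup>2) \<le> T * (\<rho> + 3 * max_edge_triangles V E * (\<rho> / N)
        + 3 * max_vertex_triangles V E * (\<rho>\<^sup>2 * (real N / real n - 1)))"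
      unfolding \<rho>_def T_def by (rule triangle_count_variance_le[OF V E n])
    also have "\<dots> \<le> T * (7 * (\<rho>\<^sup>2 / a))"
      using 1 2 3 T0 by (intro mult_left_mono) (simp_all add: mult.assoc)
    finally show ?thesis by (simp add: field_simps)
  qed
  have pos: "(\<rho> * d)\<^sup>2 > 0" using \<rho> d by simp
  have "{f. d < \<bar>?X f / \<rho> - T\<bar>} \<subseteq> {f \<in> space ?P. (\<rho> * d)\<^sup>2 \<le> (?X f - T * \<rho>)\<^sup>2}"
  proof
    fix f assume "f \<in> {f. d < \<bar>?X f / \<rho> - T\<bar>}"
    then have "\<rho> * d \<le> \<rho> * \<bar>?X f / \<rho> - T\<bar>" using \<rho> by (intro mult_left_mono) auto
    also have "\<dots> = \<bar>\<rho> * (?X f / \<rho> - T)\<bar>" using \<rho> by (simp add: abs_mult)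
    also have "\<rho> * (?X f / \<rho> - T) = ?X f - T * \<rho>" using \<rho> by (simp add: field_simps)
    finally have "(\<rho> * d)\<^sup>2 \<le> (?X f - T * \<rho>)\<^sup>2"
      using \<rho> d by (metis abs_le_square_iff abs_of_pos mult_pos_pos)
    then show "f \<in> {f \<in> space ?P. (\<rho> * d)\<^sup>2 \<le> (?X f - T * \<rho>)\<^sup>2}" by simp
  qed
  then have "measure_pmf.prob ?P {f. d < \<bar>?X f / \<rho> - T\<bar>}
      \<le> measure_pmf.prob ?P {f \<in> space ?P. (\<rho> * d)\<^sup>2 \<le> (?X f - T * \<rho>)\<^sup>2}"
    by (intro measure_pmf.finite_measure_mono) auto
  also have "\<dots> \<le> measure_pmf.expectation ?P (\<lambda>f. (?X f - T * \<rho>)\<^sup>2) / (\<rho> * d)\<^sup>2"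
    by (intro integral_Markov_inequality_measure[where A="{}"] integrable_vertex_colouring V N pos) auto
  also have "\<dots> \<le> T * 7 / a * \<rho>\<^sup>2 / (\<rho> * d)\<^sup>2"
    using var pos by (intro divide_right_mono) auto
  also have "\<dots> \<le> 1 / 16"
    using d a \<rho> by (simp add: power_mult_distrib T_def field_simps)
  finally show ?thesis unfolding \<rho>_def T_def .
qed

section \<open>Choice of the sampling rates\<close>

text \<open>Rounding a real \<open>y \<ge> 1\<close> down at most halves it.\<close>

lemma nat_floor_bounds:
  fixes y :: real
  assumes "1 \<le> y"
  obtains N :: nat where "0 < N" "real N \<le> y" "1 / real N \<le> 2 / y"
proof
  have f: "\<lfloor>y\<rfloor> \<ge> 1" using assms by simp
  then show pos: "0 < nat \<lfloor>y\<rfloor>" by simp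
  have r: "real (nat \<lfloor>y\<rfloor>) = of_int \<lfloor>y\<rfloor>" using f by simp
  show "real (nat \<lfloor>y\<rfloor>) \<le> y" unfolding r by simp
  have "y < of_int \<lfloor>y\<rfloor> + 1" by simp
  moreover have "(1::real) \<le> of_int \<lfloor>y\<rfloor>" using f by linarith
  ultimately have "y \<le> 2 * real (nat \<lfloor>y\<rfloor>)" unfolding r by linarith
  then show "1 / real (nat \<lfloor>y\<rfloor>) \<le> 2 / y" using pos assms by (simp add: field_simps)
qed

text \<open>Writing \<open>a = b ^ 3\<close> turns the power \<open>a^(2/3)\<close> into
  \<open>b\<^sup>2\<close>. The three regimes are \<open>a * W \<ge> 1\<close>, where everything is
  kept; \<open>a * U \<ge> 1\<close>, where all colours are kept; and the remaining one, where
  \<open>n < N\<close> is possible.\<close>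

lemma admissible_rates_exist:
  fixes b U W :: real
  assumes b: "b > 0" and U: "U \<ge> 1" and W: "W \<ge> 1"
  obtains n N where "admissible_rates (b ^ 3) U W n N"
    "real n / real N ^ 2 \<le> 8 * (b\<^sup>2 + b ^ 3 * sqrt U + b ^ 3 * W)"
proof -
  define a where "a = b ^ 3"
  have a: "a > 0" using b by (simp add: a_def)
  have sU: "sqrt U \<ge> 1" using U by simp
  have nn: "b\<^sup>2 > 0" "a * sqrt U > 0" "a * W > 0" using a b sU W by auto
  have "\<exists>n N. admissible_rates a U W n N \<and> real n / real N ^ 2 \<le> 8 * (b\<^sup>2 + a * sqrt U + a * W)"
  proof (cases "a * W \<ge> 1")
    case True
    have "admissible_rates a U W 1 1" by (simp add: admissible_rates_def)
    moreover have "real 1 / real 1 ^ 2 \<le> 8 * (b\<^sup>2 + a * sqrt U + a * W)"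
      using True nn unfolding power_one of_nat_1 by argo
    ultimately show ?thesis by blast
  next
    case aW: False
    have aW1: "1 \<le> 1 / (a * W)" using aW nn by simp
    show ?thesis
    proof (cases "a * U \<ge> 1")
      case True
      define h where "h = sqrt a"
      have h: "h > 0" "h * h = a" using a by (auto simp: h_def)
      have "a \<le> a * W" using a W by simp
      then have "a \<le> 1" using aW by linarith
      then have h1: "1 \<le> 1 / h" using h by (simp add: h_def)
      \<comment> \<open>The bound \<open>1 / h\<close> ensures \<open>a * N^3 \<le> N\<close>, and
        \<open>1 / (a * W)\<close> ensures \<open>a * W * N^2 \<le> N\<close>, as needed for
        \<open>n = N\<close>.\<close>
      obtain N where N: "0 < N" "real N \<le> min (1 / h) (1 / (a * W))"
          "1 / real N \<le> 2 / min (1 / h) (1 / (a * W))"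
        using nat_floor_bounds[of "min (1 / h) (1 / (a * W))"] h1 aW1 by auto
      have hN: "h * N \<le> 1" and WN: "a * W * N \<le> 1" using N h nn by (auto simp: field_simps)
      have "a * real N ^ 3 = (h * N) * (h * N) * N" by (simp add: h(2)[symmetric] eval_nat_numeral)
      also have "\<dots> \<le> 1 * real N"
        using mult_le_one[OF hN _ hN] h by (intro mult_right_mono) auto
      finally have c1: "a * real N ^ 3 \<le> real N" by simp
      have "a * W * N * N \<le> 1 * real N" using WN by (intro mult_right_mono) auto
      then have c2: "a * W * real N ^ 2 \<le> real N" by (simp add: power2_eq_square)
      \<comment> \<open>The cost \<open>1 / N\<close> contains \<open>h = sqrt a\<close>; in this
        regime \<open>a * U \<ge> 1\<close> lets the term \<open>a * sqrt U\<close> pay for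
        it.\<close>
      have "h \<le> a * sqrt U"
      proof -
        have "1 \<le> h * sqrt U" using True by (simp add: h_def flip: real_sqrt_mult)
        then have "h * 1 \<le> h * (h * sqrt U)" using h by (intro mult_left_mono) auto
        then show ?thesis by (simp add: h(2)[symmetric])
      qed
      moreover have "1 / real N \<le> 2 * h + 2 * (a * W)"
        by (rule order_trans[OF N(3)]) (use h nn in \<open>auto simp: min_def\<close>)
      moreover have "real N / real N ^ 2 = 1 / real N" using N by (simp add: power2_eq_square)
      ultimately have "real N / real N ^ 2 \<le> 8 * (b\<^sup>2 + a * sqrt U + a * W)" using nn by argo
      moreover have "admissible_rates a U W N N" using c1 c2 N by (simp add: admissible_rates_def)
      ultimately show ?thesis by blast
    next
      case aU: False
      define s where "s = sqrt U"
      have s: "s \<ge> 1" "s * s = U" using U by (auto simp: s_def)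
      define y where "y = min (max (1 / b) s) (1 / (a * W))"
      have y1: "1 \<le> y" using s aW1 by (simp add: y_def)
      obtain N where N: "0 < N" "real N \<le> y" "1 / real N \<le> 2 / y"
        using nat_floor_bounds[OF y1] by auto
      have WN: "a * W * N \<le> 1" using N nn by (auto simp: y_def field_simps)
      have "a \<le> a * W" using a W by simp
      then have "b ^ 3 \<le> 1 ^ 3" using aW by (simp add: a_def)
      then have b1: "b \<le> 1" using b by (meson linorder_not_le power_strict_mono zero_le_one zero_less_numeral)
      have "N \<le> 1 / b \<or> N \<le> s" using N(2) by (simp add: y_def le_max_iff_disj)
      then have Nor: "b * N \<le> 1 \<or> N \<le> s" using b by (auto simp: field_simps)
      \<comment> \<open>This makes the demand \<open>a * N^3\<close> on \<open>n\<close> at most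
        \<open>N\<close>. It holds since \<open>N\<close> is at most \<open>1 / b\<close> with
        \<open>b \<le> 1\<close>, or at most \<open>sqrt U\<close> with
        \<open>a * U < 1\<close>.\<close>
      have aNN: "a * (real N * real N) \<le> 1"
        using Nor
      proof
        assume "b * N \<le> 1"
        then have "(b * N) * (b * N) \<le> 1" using b mult_le_one[of "b * N" "b * N"] by simp
        then have "b * ((b * N) * (b * N)) \<le> 1" using b b1 mult_le_one[of b "(b * N) * (b * N)"] by simp
        then show ?thesis by (simp add: a_def eval_nat_numeral algebra_simps)
      next
        assume "real N \<le> s"
        then have "real N * real N \<le> U" unfolding s(2)[symmetric] using s by (intro mult_mono) auto
        then have "a * (real N * real N) \<le> a * U" using a by simp
        then show ?thesis using aU by simp
      qed
      \<comment> \<open>The largest of the three lower bounds that \<open>admissible_rates\<close>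
        puts on \<open>n\<close>. Rounding it up costs at most 1, hence the extra
        \<open>1 / N^2\<close> in the edge rate.\<close>
      define M where "M = max (a * real N ^ 3) (max (a * W * real N ^ 2) (a * U * real N))"
      define n where "n = nat \<lceil>M\<rceil>"
      have "a * U * real N > 0" using a U N by simp
      then have M0: "M > 0" by (simp add: M_def less_max_iff_disj)
      then have n0: "n > 0" and Mn: "M \<le> real n" by (auto simp: n_def)
      have nM: "real n \<le> M + 1" using M0 unfolding n_def by linarith
      have "M \<le> N"
      proof -
        have "a * real N ^ 3 = a * (real N * real N) * N" by (simp add: eval_nat_numeral)
        also have "\<dots> \<le> 1 * real N" using aNN by (intro mult_right_mono) auto
        finally have 1: "a * real N ^ 3 \<le> N" by simp
        have "a * W * N * N \<le> 1 * real N" using WN by (intro mult_right_mono) auto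
        then have 2: "a * W * real N ^ 2 \<le> real N" by (simp add: power2_eq_square)
        have "a * U * N \<le> 1 * real N" using aU by (intro mult_right_mono) auto
        then show ?thesis using 1 2 by (simp add: M_def)
      qed
      then have nN: "n \<le> N" unfolding n_def by (simp add: nat_le_iff ceiling_le_iff)
      have adm: "admissible_rates a U W n N"
        using n0 nN Mn by (auto simp: admissible_rates_def M_def)
      \<comment> \<open>Either \<open>y\<close> is the uncut maximum, and \<open>1 / y\<close> is
        below both reciprocals, or the cutoff is active.\<close>
      have yor: "(1 / y \<le> b \<and> 1 / y \<le> 1 / s) \<or> 1 / y = a * W"
      proof (cases "max (1 / b) s \<le> 1 / (a * W)")
        case True
        then have "1 / b \<le> y" "s \<le> y" by (auto simp: y_def)
        then show ?thesis using b s y1 by (auto simp: field_simps)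
      qed (auto simp: y_def)
      have "M \<le> a * real N ^ 3 + a * W * real N ^ 2 + a * U * real N"
        using nn a N U W by (auto simp: M_def)
      then have "real n / real N ^ 2 \<le> (a * real N ^ 3 + a * W * real N ^ 2 + a * U * real N + 1) / real N ^ 2"
        using nM by (intro divide_right_mono) auto
      also have "\<dots> = a * N + a * W + a * U * (1 / real N) + (1 / real N) * (1 / real N)"
        using N by (simp add: field_simps eval_nat_numeral)
      also have "\<dots> \<le> (b\<^sup>2 + a * s) + a * W + (2 * (a * s) + 2 * (a * W)) + (4 * b\<^sup>2 + 4 * (a * W))"
      proof -
        have 1: "a * N \<le> b\<^sup>2 + a * s"
          using Nor
        proof
          assume "b * N \<le> 1"
          then have "b\<^sup>2 * (b * N) \<le> b\<^sup>2 * 1" by (intro mult_left_mono) auto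
          then have "a * N \<le> b\<^sup>2" by (simp add: a_def eval_nat_numeral mult.assoc)
          moreover have "a * s > 0" using a s by simp
          ultimately show ?thesis by linarith
        next
          assume "real N \<le> s"
          then have "a * N \<le> a * s" using a by simp
          then show ?thesis using nn by linarith
        qed
        have 2: "a * U * (1 / real N) \<le> 2 * (a * s) + 2 * (a * W)"
        proof -
          have "a * U * (1 / real N) \<le> a * U * (2 * (1 / y))" using N(3) a U by (intro mult_left_mono) auto
          also have "\<dots> \<le> 2 * (a * s) + 2 * (a * W)"
            using yor
          proof
            assume "1 / y \<le> b \<and> 1 / y \<le> 1 / s"
            then have "a * U * (2 * (1 / y)) \<le> a * U * (2 * (1 / s))" using a U by (intro mult_left_mono) auto
            also have "\<dots> = 2 * (a * s)" using s by (simp add: s(2)[symmetric])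
            finally show ?thesis using nn by linarith
          next
            assume *: "1 / y = a * W"
            have "a * U * (2 * (a * W)) \<le> 1 * (2 * (a * W))" using aU nn by (intro mult_right_mono) auto
            moreover have "a * s > 0" using a s by simp
            ultimately show ?thesis unfolding * by linarith
          qed
          finally show ?thesis .
        qed
        have 3: "(1 / real N) * (1 / real N) \<le> 4 * b\<^sup>2 + 4 * (a * W)"
        proof -
          have "(1 / real N) * (1 / real N) \<le> (2 * (1 / y)) * (2 * (1 / y))"
            using N(3) y1 by (intro mult_mono) auto
          also have "\<dots> = 4 * ((1 / y) * (1 / y))" by simp
          also have "\<dots> \<le> 4 * b\<^sup>2 + 4 * (a * W)"
            using yor
          proof
            assume "1 / y \<le> b \<and> 1 / y \<le> 1 / s"
            then have "(1 / y) * (1 / y) \<le> b * b" using b y1 by (intro mult_mono) auto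
            then show ?thesis using nn by (simp add: power2_eq_square)
          next
            \<comment> \<open>When the cutoff is active, \<open>a * W < 1\<close> reduces the square
              of \<open>a * W\<close> to its first power.\<close>
            assume *: "1 / y = a * W"
            have "(a * W) * (a * W) \<le> 1 * (a * W)" using aW nn by (intro mult_right_mono) auto
            then show ?thesis unfolding * using nn by linarith
          qed
          finally show ?thesis .
        qed
        show ?thesis using 1 2 3 by linarith
      qed
      \<comment> \<open>The coefficients of the three terms add up to 5, 3 and 7.\<close>
      also have "\<dots> \<le> 8 * (b\<^sup>2 + a * sqrt U + a * W)" using nn unfolding s_def[symmetric] by argo
      finally show ?thesis using adm by blast
    qed
  qed
  then show ?thesis using that unfolding a_def by blast
qed

section \<open>Medians of independent repetitions\<close>

text \<open>This is the lower median: the least entry having at least half of the entries at or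
  below it. No sorting is involved, and for \<open>k > 0\<close> the value is one of the
  entries.\<close>

definition median :: "nat \<Rightarrow> (nat \<Rightarrow> real) \<Rightarrow> real" where
  "median k x = Min {y \<in> x ` {..<k}. k \<le> 2 * card {i. i < k \<and> x i \<le> y}}"

lemma median_cong:
  assumes "\<And>i. i < k \<Longrightarrow> x i = y i"
  shows "median k x = median k y"
proof -
  have "x ` {..<k} = y ` {..<k}" using assms by (intro image_cong) auto
  moreover have "{i. i < k \<and> x i \<le> z} = {i. i < k \<and> y i \<le> z}" for z using assms by auto
  ultimately show ?thesis by (simp add: median_def)
qed

text \<open>The entries within \<open>d\<close> of \<open>t\<close> form a strict majority. The
  largest of them is a candidate for the minimum, which bounds the median above; at least half of
  the entries lie at or below the median, so one of them is good, which bounds it below.\<close>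

lemma median_within:
  fixes x :: "nat \<Rightarrow> real"
  assumes maj: "2 * card {i. i < k \<and> d < \<bar>x i - t\<bar>} < k"
  shows "\<bar>median k x - t\<bar> \<le> d"
proof -
  define G where "G = {i. i < k \<and> \<bar>x i - t\<bar> \<le> d}"
  define B where "B = {i. i < k \<and> d < \<bar>x i - t\<bar>}"
  define M where "M = {y \<in> x ` {..<k}. k \<le> 2 * card {i. i < k \<and> x i \<le> y}}"
  have fin: "finite G" "finite B" "finite M" by (auto simp: G_def B_def M_def)
  have "G \<union> B = {..<k}" "G \<inter> B = {}" by (auto simp: G_def B_def)
  then have GB: "card G + card B = k" using fin card_Un_disjoint by (metis card_lessThan)
  have G: "k < 2 * card G" using GB maj by (simp add: B_def)
  then have Gne: "G \<noteq> {}" by auto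
  define z where "z = Max (x ` G)"
  have "z \<in> x ` G" unfolding z_def using fin Gne by (intro Max_in) auto
  then have zk: "z \<in> x ` {..<k}" "z \<le> t + d" by (auto simp: G_def)
  have "G \<subseteq> {i. i < k \<and> x i \<le> z}" unfolding z_def using fin by (auto simp: G_def intro!: Max_ge)
  then have "card G \<le> card {i. i < k \<and> x i \<le> z}" by (intro card_mono) auto
  then have zM: "z \<in> M" using zk G by (simp add: M_def)
  have med: "median k x = Min M" by (simp add: median_def M_def)
  have upper: "median k x \<le> t + d" using Min_le[OF fin(3) zM] zk med by simp
  have "median k x \<in> M" unfolding med using fin zM by (intro Min_in) auto
  then have half: "k \<le> 2 * card {i. i < k \<and> x i \<le> median k x}" by (simp add: M_def)
  have "G \<inter> {i. i < k \<and> x i \<le> median k x} \<noteq> {}"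
  proof
    assume "G \<inter> {i. i < k \<and> x i \<le> median k x} = {}"
    then have "{i. i < k \<and> x i \<le> median k x} \<subseteq> B" by (auto simp: G_def B_def)
    then have "card {i. i < k \<and> x i \<le> median k x} \<le> card B" using fin by (intro card_mono) auto
    then show False using half maj by (simp add: B_def)
  qed
  then have "t - d \<le> median k x" by (auto simp: G_def)
  then show ?thesis using upper by linarith
qed

text \<open>Markov's inequality for 16 to the number of failures, whose expectation is at most \<open>2 ^ k\<close>.\<close>

lemma prob_half_fail_le:
  fixes p :: "'a pmf"
  assumes fin: "finite (set_pmf p)" and fail: "measure_pmf.prob p B \<le> 1 / 16"
  shows "measure_pmf.prob (Pi_pmf {..<k} d (\<lambda>_. p)) {g. k \<le> 2 * card {i. i < k \<and> g i \<in> B}} \<le> (1 / 2) ^ k"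
proof -
  let ?Q = "Pi_pmf {..<k} d (\<lambda>_. p)"
  let ?u = "\<lambda>g. \<Prod>i<k. 1 + 15 * indicator B (g i) :: real"
  have finQ: "finite (set_pmf ?Q)" by (intro finite_set_pmf_Pi_pmf fin) auto
  have u: "?u g = 16 ^ card {i. i < k \<and> g i \<in> B}" for g
  proof -
    have "?u g = (\<Prod>i<k. if i \<in> {i. g i \<in> B} then 16 else 1)" by (intro prod.cong) (auto simp: indicator_def)
    also have "\<dots> = 16 ^ card ({..<k} \<inter> {i. g i \<in> B})" by (subst prod.If_cases) auto
    finally show ?thesis by (simp add: Int_def)
  qed
  have "measure_pmf.expectation ?Q ?u = (\<Prod>i<k. measure_pmf.expectation p (\<lambda>y. 1 + 15 * indicator B y))"
    by (rule expectation_prod_Pi_pmf) (auto intro!: integrable_measure_pmf_finite fin)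
  also have "measure_pmf.expectation p (\<lambda>y. 1 + 15 * indicator B y) = 1 + 15 * measure_pmf.prob p B"
    by (subst Bochner_Integration.integral_add) (auto intro!: integrable_measure_pmf_finite fin)
  also have "(\<Prod>i<k. 1 + 15 * measure_pmf.prob p B) \<le> (\<Prod>i<k. 2)"
    using fail by (intro prod_mono) auto
  finally have Eu: "measure_pmf.expectation ?Q ?u \<le> 2 ^ k" by simp
  \<comment> \<open>Failures in at least half of the copies make 16 to their number at least
    \<open>4 ^ k\<close>, so Markov's inequality gives \<open>2 ^ k / 4 ^ k\<close>.\<close>
  have "{g. k \<le> 2 * card {i. i < k \<and> g i \<in> B}} \<subseteq> {g \<in> space ?Q. 4 ^ k \<le> ?u g}"
  proof
    fix g assume "g \<in> {g. k \<le> 2 * card {i. i < k \<and> g i \<in> B}}"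
    then have "(4::real) ^ k \<le> 4 ^ (2 * card {i. i < k \<and> g i \<in> B})" by (intro power_increasing) auto
    also have "\<dots> = ?u g" unfolding u power_mult by simp
    finally show "g \<in> {g \<in> space ?Q. 4 ^ k \<le> ?u g}" by simp
  qed
  then have "measure_pmf.prob ?Q {g. k \<le> 2 * card {i. i < k \<and> g i \<in> B}}
     \<le> measure_pmf.prob ?Q {g \<in> space ?Q. 4 ^ k \<le> ?u g}"
    by (intro measure_pmf.finite_measure_mono) auto
  also have "\<dots> \<le> measure_pmf.expectation ?Q ?u / 4 ^ k"
    by (intro integral_Markov_inequality_measure[where A="{}"] integrable_measure_pmf_finite finQ)
       (auto intro!: prod_nonneg)
  also have "\<dots> \<le> 2 ^ k / 4 ^ k" using Eu by (intro divide_right_mono) auto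
  also have "\<dots> = (2 / 4) ^ k" by (rule power_divide[symmetric])
  finally show ?thesis by simp
qed

section \<open>The algorithm\<close>

text \<open>The \<open>k\<close> copies share one sampled set, the union of their pair sets. The
  decision rule knows the colourings \<open>g i\<close> and recovers each copy's sample by
  intersecting.\<close>

definition hybrid_alg :: "'v set \<Rightarrow> nat \<Rightarrow> nat \<Rightarrow> nat \<Rightarrow> real \<Rightarrow> 'v sampling_alg" where
  "hybrid_alg V n N k \<theta> = map_pmf
     (\<lambda>g. (\<Union>i<k. coloured_pairs V n (g i),
           \<lambda>K. let x = median k (\<lambda>i. real (num_triangles V (K \<inter> coloured_pairs V n (g i))) / (real n / real N ^ 3))
               in if x < \<theta> then Guess_Too_Large else Estimate x))
     (Pi_pmf {..<k} (\<lambda>_. 0) (\<lambda>_. vertex_colouring V N))"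

lemma finite_set_pmf_hybrid_alg:
  assumes "finite V" "N > 0"
  shows "finite (set_pmf (hybrid_alg V n N k \<theta>))"
  unfolding hybrid_alg_def set_map_pmf
  by (intro finite_imageI finite_set_pmf_Pi_pmf finite_set_pmf_vertex_colouring assms) auto

lemma samples_pairs_of_hybrid_alg: "samples_pairs_of V (hybrid_alg V n N k \<theta>)"
  by (auto simp: samples_pairs_of_def hybrid_alg_def coloured_pairs_def)

text \<open>Combining the demands for small and large guesses lets one probability bound serve
  both.\<close>

definition acceptable :: "real \<Rightarrow> real \<Rightarrow> real \<Rightarrow> verdict set" where
  "acceptable \<epsilon> T' T =
     (if T' \<le> T then good_estimates \<epsilon> T else {Guess_Too_Large} \<union> good_estimates \<epsilon> T)"

lemma thresholded_estimate_acceptable: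
  assumes "0 < \<epsilon>" "\<epsilon> < 1" "0 < T'" "0 \<le> T" and x: "\<bar>x - T\<bar> \<le> \<epsilon> / 4 * max T T'"
  shows "(if x < (1 - \<epsilon> / 4) * T' then Guess_Too_Large else Estimate x) \<in> acceptable \<epsilon> T' T"
proof (cases "T' \<le> T")
  case True
  then have d: "\<bar>x - T\<bar> \<le> \<epsilon> / 4 * T" using x by (simp add: max_def)
  have "(1 - \<epsilon> / 4) * T' \<le> (1 - \<epsilon> / 4) * T" using True assms by (intro mult_left_mono) auto
  also have "\<dots> \<le> x" unfolding left_diff_distrib using d by linarith
  finally have "\<not> x < (1 - \<epsilon> / 4) * T'" by simp
  moreover have "\<epsilon> / 4 * T \<le> \<epsilon> * T" using assms by (intro mult_right_mono) auto
  then have "\<bar>x - T\<bar> \<le> \<epsilon> * T" using d by linarith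
  ultimately show ?thesis using True by (auto simp: acceptable_def good_estimates_def)
next
  case False
  then have d: "\<bar>x - T\<bar> \<le> \<epsilon> / 4 * T'" using x by (simp add: max_def)
  show ?thesis
  proof (cases "x < (1 - \<epsilon> / 4) * T'")
    case x: False
    \<comment> \<open>Passing the threshold loses \<open>\<epsilon> / 4\<close>, the estimation
      error another \<open>\<epsilon> / 4\<close>, both relative to \<open>T'\<close>.\<close>
    then have "(1 - \<epsilon> / 2) * T' \<le> T" using d by (simp add: algebra_simps abs_if split: if_splits)
    moreover have "1 / 2 * T' \<le> (1 - \<epsilon> / 2) * T'" using assms by (intro mult_right_mono) auto
    ultimately have "T' \<le> 2 * T" by linarith
    then have "\<epsilon> / 4 * T' \<le> \<epsilon> / 4 * (2 * T)" using assms by (intro mult_left_mono) auto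
    also have "\<dots> \<le> \<epsilon> * T" using assms by simp
    finally show ?thesis using False x d by (auto simp: acceptable_def good_estimates_def)
  qed (use False in \<open>simp add: acceptable_def\<close>)
qed

lemma prob_hybrid_alg_acceptable:
  fixes V :: "'v set"
  assumes V: "finite V" and E: "E \<subseteq> vertex_pairs V" and es: "edge_stream E es"
    and U: "real (max_vertex_triangles V E) \<le> U" and W: "real (max_edge_triangles V E) \<le> W"
    and \<epsilon>: "0 < \<epsilon>" "\<epsilon> < 1" and T': "0 < T'"
    and rates: "admissible_rates (1792 / (\<epsilon>\<^sup>2 * T')) U W n N"
  shows "measure_pmf.prob (output_dist (hybrid_alg V n N k ((1 - \<epsilon> / 4) * T')) es)
      (acceptable \<epsilon> T' (real (num_triangles V E))) \<ge> 1 - (1 / 2) ^ k"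
proof -
  define T where "T = real (num_triangles V E)"
  define d where "d = \<epsilon> / 4 * max T T'"
  define X where "X = (\<lambda>f. real (num_triangles V (E \<inter> coloured_pairs V n f)) / (real n / real N ^ 3))"
  define B where "B = {f. d < \<bar>X f - T\<bar>}"
  define out where "out = (\<lambda>g. let x = median k (\<lambda>i. X (g i)) in
     if x < (1 - \<epsilon> / 4) * T' then Guess_Too_Large else Estimate x)"
  let ?Q = "Pi_pmf {..<k} (\<lambda>_. 0) (\<lambda>_. vertex_colouring V N)"
  let ?fail = "{g. k \<le> 2 * card {i. i < k \<and> g i \<in> B}}"
  have N: "N > 0" using rates by (auto simp: admissible_rates_def)
  have T0: "T \<ge> 0" by (simp add: T_def)
  have d: "d > 0" using \<epsilon> T' by (simp add: d_def less_max_iff_disj)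
  \<comment> \<open>It follows that \<open>d\<^sup>2 \<ge> \<epsilon>\<^sup>2 * T * T' / 16\<close>.
    The concentration lemma asks for \<open>112 * T \<le> a * d\<^sup>2\<close>, and
    \<open>1792 = 112 * 16\<close>.\<close>
  have "T * T' \<le> max T T' * max T T'" using T0 T' by (intro mult_mono) auto
  then have "112 * T \<le> 1792 / (\<epsilon>\<^sup>2 * T') * d\<^sup>2"
    using \<epsilon> T' by (simp add: d_def field_simps power2_eq_square)
  then have "measure_pmf.prob (vertex_colouring V N) B \<le> 1 / 16"
    unfolding B_def X_def T_def
    by (intro triangle_estimate_concentrated[OF V E rates _ U W d]) (use \<epsilon> T' in auto)
  then have fail: "measure_pmf.prob ?Q ?fail \<le> (1 / 2) ^ k"
    by (intro prob_half_fail_le finite_set_pmf_vertex_colouring V N)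
  have "output_dist (hybrid_alg V n N k ((1 - \<epsilon> / 4) * T')) es = map_pmf out ?Q"
    unfolding output_dist_def hybrid_alg_def map_pmf_comp
  proof (intro map_pmf_cong refl)
    fix g :: "nat \<Rightarrow> 'v \<Rightarrow> nat"
    \<comment> \<open>Copy \<open>i\<close> is recovered from the union for \<open>i < k\<close>
      only, which suffices by \<open>median_cong\<close>.\<close>
    have K: "E \<inter> (\<Union>i<k. coloured_pairs V n (g i)) \<inter> coloured_pairs V n (g i) = E \<inter> coloured_pairs V n (g i)"
      if "i < k" for i using that by auto
    have "median k (\<lambda>i. real (num_triangles V (E \<inter> (\<Union>i<k. coloured_pairs V n (g i)) \<inter> coloured_pairs V n (g i))) / (real n / real N ^ 3))
        = median k (\<lambda>i. X (g i))"
      by (intro median_cong) (simp add: X_def K)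
    then show "(case (\<Union>i<k. coloured_pairs V n (g i),
           \<lambda>K. let x = median k (\<lambda>i. real (num_triangles V (K \<inter> coloured_pairs V n (g i))) / (real n / real N ^ 3))
               in if x < (1 - \<epsilon> / 4) * T' then Guess_Too_Large else Estimate x) of
          (S, f) \<Rightarrow> f (kept_edges S es)) = out g"
      by (simp add: kept_edges_eq[OF es] out_def)
  qed
  moreover have "- ?fail \<subseteq> out -` acceptable \<epsilon> T' T"
  proof
    fix g assume "g \<in> - ?fail"
    then have "\<bar>median k (\<lambda>i. X (g i)) - T\<bar> \<le> d" by (intro median_within) (simp add: B_def)
    then show "g \<in> out -` acceptable \<epsilon> T' T"
      using thresholded_estimate_acceptable[OF \<epsilon> T' T0] by (simp add: out_def d_def Let_def)
  qed
  then have "measure_pmf.prob ?Q (- ?fail) \<le> measure_pmf.prob ?Q (out -` acceptable \<epsilon> T' T)"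
    by (intro measure_pmf.finite_measure_mono) auto
  moreover have "measure_pmf.prob ?Q (- ?fail) = 1 - measure_pmf.prob ?Q ?fail"
    using measure_pmf.prob_compl[of ?fail ?Q] by (simp add: Compl_eq_Diff_UNIV)
  ultimately show ?thesis using fail by (simp add: T_def)
qed

text \<open>A union bound over the copies; each coordinate of the product distribution is a single
  colouring.\<close>

lemma expected_samples_hybrid_alg_le:
  fixes V :: "'v set"
  assumes V: "finite V" and E: "E \<subseteq> vertex_pairs V" and es: "edge_stream E es" and n: "0 < N" "n \<le> N"
  shows "expected_samples (hybrid_alg V n N k \<theta>) es \<le> real k * real (card E) * (real n / real N ^ 2)"
proof -
  let ?Q = "Pi_pmf {..<k} (\<lambda>_. 0) (\<lambda>_. vertex_colouring V N)"
  let ?c = "\<lambda>f. real (card (E \<inter> coloured_pairs V n f))"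
  have int: "integrable ?Q h" for h :: "_ \<Rightarrow> real"
    by (intro integrable_measure_pmf_finite finite_set_pmf_Pi_pmf finite_set_pmf_vertex_colouring V n) auto
  have comp: "measure_pmf.expectation ?Q (\<lambda>g. ?c (g i)) = real (card E) * (real n / real N ^ 2)"
    if "i < k" for i
  proof -
    have "measure_pmf.expectation ?Q (\<lambda>g. ?c (g i)) = measure_pmf.expectation (map_pmf (\<lambda>g. g i) ?Q) ?c"
      by simp
    also have "map_pmf (\<lambda>g. g i) ?Q = vertex_colouring V N" using that by (simp add: Pi_pmf_component)
    finally show ?thesis using expectation_card_kept_edges[OF V E n] by simp
  qed
  have "expected_samples (hybrid_alg V n N k \<theta>) es =
      measure_pmf.expectation ?Q (\<lambda>g. real (card (\<Union>i<k. E \<inter> coloured_pairs V n (g i))))"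
    by (simp add: expected_samples_def hybrid_alg_def kept_edges_eq[OF es] case_prod_beta)
  also have "\<dots> \<le> measure_pmf.expectation ?Q (\<lambda>g. \<Sum>i<k. ?c (g i))"
  proof (intro integral_mono int)
    fix g :: "nat \<Rightarrow> 'v \<Rightarrow> nat"
    have "card (\<Union>i<k. E \<inter> coloured_pairs V n (g i)) \<le> (\<Sum>i<k. card (E \<inter> coloured_pairs V n (g i)))"
      by (rule card_UN_le) simp
    then show "real (card (\<Union>i<k. E \<inter> coloured_pairs V n (g i))) \<le> (\<Sum>i<k. ?c (g i))"
      by (metis of_nat_le_iff of_nat_sum)
  qed
  also have "\<dots> = (\<Sum>i<k. real (card E) * (real n / real N ^ 2))"
    by (simp add: Bochner_Integration.integral_sum int comp)
  finally show ?thesis by simp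
qed

section \<open>Thinning for failure probabilities near 1\<close>

text \<open>
  As \<open>\<delta>\<close> tends to 1 the sample budget tends to 0, so even one run is too expensive; running the
  algorithm with probability \<open>2 * (1 - \<delta>)\<close> only is then still good enough.
\<close>

definition thinned :: "real \<Rightarrow> 'v sampling_alg \<Rightarrow> 'v sampling_alg" where
  "thinned l A = bind_pmf (bernoulli_pmf l) (\<lambda>b. if b then A else return_pmf ({}, \<lambda>_. Guess_Too_Large))"

lemma expectation_thinned:
  fixes h :: "_ \<Rightarrow> real"
  assumes "finite (set_pmf A)" "0 \<le> l" "l \<le> 1"
  shows "measure_pmf.expectation (thinned l A) h
    = l * measure_pmf.expectation A h + (1 - l) * h ({}, \<lambda>_. Guess_Too_Large)"
  unfolding thinned_def
  using assms by (subst pmf_expectation_bind[of UNIV]) (auto simp: UNIV_bool)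

lemma samples_pairs_of_thinned: "samples_pairs_of V A \<Longrightarrow> samples_pairs_of V (thinned l A)"
  by (auto simp: samples_pairs_of_def thinned_def split: if_splits)

lemma expected_samples_thinned:
  assumes "finite (set_pmf A)" "0 \<le> l" "l \<le> 1" "edge_stream E es"
  shows "expected_samples (thinned l A) es = l * expected_samples A es"
  unfolding expected_samples_def
  using assms by (simp add: expectation_thinned kept_edges_eq)

lemma prob_output_thinned_ge:
  assumes "finite (set_pmf A)" "0 \<le> l" "l \<le> 1"
  shows "measure_pmf.prob (output_dist (thinned l A) es) X \<ge> l * measure_pmf.prob (output_dist A es) X"
proof -
  have *: "measure_pmf.prob (output_dist B es) X =
     measure_pmf.expectation B (indicator ((\<lambda>(S, f). f (kept_edges S es)) -` X))" for B
    by (simp add: output_dist_def)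
  show ?thesis unfolding * expectation_thinned[OF assms] using assms by (simp add: indicator_def)
qed

section \<open>Repetition count and sampling rates from the parameters\<close>

text \<open>For \<open>\<delta> \<le> 1 / 2\<close> the algorithm always runs, with \<open>k\<close>
  the rounded-up binary logarithm of \<open>1 / \<delta>\<close>: rounding costs a factor 2 and
  \<open>ln 2 \<ge> 2 / 3\<close> another \<open>3 / 2\<close>. Otherwise one copy runs with
  probability \<open>2 * (1 - \<delta>)\<close>, and \<open>ln \<delta> \<le> \<delta> - 1\<close>
  bounds the cost.\<close>

lemma repetitions_exist:
  fixes \<delta> :: real
  assumes "0 < \<delta>" "\<delta> < 1"
  obtains l k where "0 \<le> l" "l \<le> 1" "1 - \<delta> \<le> l * (1 - (1 / 2) ^ k)" "l * real k \<le> 3 * ln (1 / \<delta>)"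
proof (cases "\<delta> \<le> 1 / 2")
  case True
  define k where "k = nat \<lceil>log 2 (1 / \<delta>)\<rceil>"
  have ge1: "log 2 (1 / \<delta>) \<ge> 1" using True assms by (simp add: le_log_iff field_simps)
  then have k: "log 2 (1 / \<delta>) \<le> real k" "real k \<le> log 2 (1 / \<delta>) + 1" unfolding k_def by linarith+
  have "1 / \<delta> = 2 powr (log 2 (1 / \<delta>))" using assms by simp
  also have "\<dots> \<le> 2 powr (real k)" using k by (intro powr_mono) auto
  finally have "1 / \<delta> \<le> 2 ^ k" by (simp add: powr_realpow)
  then have "(1 / 2) ^ k \<le> \<delta>" using assms by (simp add: power_one_over field_simps)
  moreover have "real k \<le> 3 * ln (1 / \<delta>)"
  proof -
    have "real k * ln 2 \<le> (2 * log 2 (1 / \<delta>)) * ln 2" using k ge1 by (intro mult_right_mono) auto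
    then have "real k * ln 2 \<le> 2 * ln (1 / \<delta>)" by (simp add: log_def)
    moreover have "real k * (2 / 3) \<le> real k * ln 2" using ln2_ge_two_thirds by (intro mult_left_mono) auto
    ultimately show ?thesis by linarith
  qed
  ultimately show ?thesis using that[of 1 k] by simp
next
  case False
  have "ln \<delta> \<le> \<delta> - 1" using assms by (intro ln_le_minus_one) auto
  then have "2 * (1 - \<delta>) \<le> 3 * ln (1 / \<delta>)" using assms by (simp add: ln_div)
  then show ?thesis using False assms that[of "2 * (1 - \<delta>)" 1] by simp
qed

text \<open>The rates are fixed by the known upper bounds \<open>U\<close> and \<open>W\<close>
  before the graph is seen, so the cost bound is stated for all true values \<open>u\<close> and
  \<open>w\<close> that these may overestimate by \<open>c\<^sup>2\<close>. The constant is
  \<open>14336 = 8 * 1792\<close>.\<close>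

lemma sampling_rates_exist:
  fixes \<epsilon> T' U W c :: real
  assumes \<epsilon>: "0 < \<epsilon>" "\<epsilon> < 1" and T': "0 < T'" and U: "U \<ge> 1" and W: "W \<ge> 1" and c: "c \<ge> 1"
  obtains n N where "admissible_rates (1792 / (\<epsilon>\<^sup>2 * T')) U W n N"
    "\<And>u w. U \<le> c\<^sup>2 * u \<Longrightarrow> W \<le> c\<^sup>2 * w \<Longrightarrow> real n / real N ^ 2 \<le> 14336 * c\<^sup>2 / \<epsilon>\<^sup>2 *
       (1 / T' powr (2 / 3) + sqrt u * log_plus T' / T' + w * log_plus T' / T')"
proof (cases "T' < 3")
  \<comment> \<open>Here the logarithm may vanish, but the term \<open>T' powr (- 2 / 3)\<close> pays for keeping every edge.\<close>
  case True
  have adm: "admissible_rates (1792 / (\<epsilon>\<^sup>2 * T')) U W 1 1" by (simp add: admissible_rates_def)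
  have "real 1 / real 1 ^ 2 \<le> 14336 * c\<^sup>2 / \<epsilon>\<^sup>2 *
       (1 / T' powr (2 / 3) + sqrt u * log_plus T' / T' + w * log_plus T' / T')"
    if u: "U \<le> c\<^sup>2 * u" and w: "W \<le> c\<^sup>2 * w" for u w
  proof -
    have uw: "u \<ge> 0" "w \<ge> 0" using u w U W c by (smt (verit) mult_nonneg_nonpos zero_le_power2)+
    have "T' powr (2 / 3) \<le> 3 powr (2 / 3)" using True T' by (intro powr_mono2) auto
    also have "\<dots> \<le> 3 powr 1" by (intro powr_mono) auto
    finally have "T' powr (2 / 3) \<le> 3" by simp
    then have "1 / 3 \<le> 1 / T' powr (2 / 3)" using T' by (simp add: field_simps)
    moreover have "0 \<le> sqrt u * log_plus T' / T'" "0 \<le> w * log_plus T' / T'"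
      using uw T' by (auto simp: log_plus_def)
    ultimately have s: "1 / 3 \<le> 1 / T' powr (2 / 3) + sqrt u * log_plus T' / T' + w * log_plus T' / T'"
      by linarith
    have "\<epsilon>\<^sup>2 \<le> 1" using \<epsilon> by (simp add: power_le_one)
    moreover have "1 \<le> c\<^sup>2" using c by simp
    ultimately have "14336 \<le> 14336 * c\<^sup>2 / \<epsilon>\<^sup>2" using \<epsilon> by (simp add: field_simps)
    then have "14336 * (1 / 3) \<le> 14336 * c\<^sup>2 / \<epsilon>\<^sup>2 *
       (1 / T' powr (2 / 3) + sqrt u * log_plus T' / T' + w * log_plus T' / T')"
      using s by (intro mult_mono) auto
    then show ?thesis by simp
  qed
  then show ?thesis using that adm by blast
next
  case False
  define x where "x = 1792 / \<epsilon>\<^sup>2"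
  define a where "a = x / T'"
  define b where "b = a powr (1 / 3)"
  have "\<epsilon>\<^sup>2 \<le> 1" using \<epsilon> by (simp add: power_le_one)
  then have x: "x \<ge> 1" using \<epsilon> by (simp add: x_def field_simps)
  have a: "a > 0" using x T' by (simp add: a_def)
  have b: "b > 0" using a by (simp add: b_def)
  have b3: "b ^ 3 = a" using a by (simp add: b_def flip: powr_realpow add: powr_powr)
  have "b\<^sup>2 = a powr (2 / 3)" using a by (simp add: b_def flip: powr_realpow add: powr_powr)
  also have "\<dots> = x powr (2 / 3) / T' powr (2 / 3)" using x T' by (simp add: a_def powr_divide)
  \<comment> \<open>As \<open>x \<ge> 1\<close>, raising its exponent to 1 produces the common
    factor of order \<open>1 / \<epsilon>\<^sup>2\<close>.\<close>
  also have "\<dots> \<le> x powr 1 / T' powr (2 / 3)" using x by (intro divide_right_mono powr_mono) auto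
  finally have b2: "b\<^sup>2 \<le> x * (1 / T' powr (2 / 3))" using x by simp
  have aeq: "1792 / (\<epsilon>\<^sup>2 * T') = a" by (simp add: a_def x_def)
  obtain n N where adm: "admissible_rates a U W n N"
    and cost: "real n / real N ^ 2 \<le> 8 * (b\<^sup>2 + a * sqrt U + a * W)"
    using admissible_rates_exist[OF b U W] unfolding b3 by blast
  \<comment> \<open>The cut at 3 makes the logarithm at least 1, so it can be multiplied into the
    last two terms.\<close>
  have "ln 3 \<ge> (1::real)"
    using exp_le by (simp add: ln_ge_iff)
  then have lp: "log_plus T' \<ge> 1" using False T' by (smt (verit) ln_le_cancel_iff log_plus_def)
  have "real n / real N ^ 2 \<le> 14336 * c\<^sup>2 / \<epsilon>\<^sup>2 *
       (1 / T' powr (2 / 3) + sqrt u * log_plus T' / T' + w * log_plus T' / T')"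
    if u: "U \<le> c\<^sup>2 * u" and w: "W \<le> c\<^sup>2 * w" for u w
  proof -
    have uw: "u \<ge> 0" "w \<ge> 0" using u w U W c by (smt (verit) mult_nonneg_nonpos zero_le_power2)+
    have c2: "1 \<le> c\<^sup>2" "c \<le> c\<^sup>2" using c mult_left_mono[of 1 c c] by (auto simp: power2_eq_square intro: order_trans)
    have 1: "b\<^sup>2 \<le> x * c\<^sup>2 * (1 / T' powr (2 / 3))"
    proof -
      have "x * 1 * (1 / T' powr (2 / 3)) \<le> x * c\<^sup>2 * (1 / T' powr (2 / 3))"
        using x c2 by (intro mult_right_mono mult_left_mono) auto
      then show ?thesis using b2 by simp
    qed
    have 2: "a * sqrt U \<le> x * c\<^sup>2 * (sqrt u * log_plus T' / T')"
    proof -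
      have "sqrt U \<le> sqrt (c\<^sup>2 * u)" using u by simp
      also have "\<dots> = c * sqrt u" using c by (simp add: real_sqrt_mult)
      also have "\<dots> \<le> c\<^sup>2 * (sqrt u * log_plus T')"
      proof -
        have "sqrt u * 1 \<le> sqrt u * log_plus T'" using lp uw by (intro mult_left_mono) auto
        then show ?thesis using c c2 uw lp by (intro mult_mono) auto
      qed
      finally have "a * sqrt U \<le> a * (c\<^sup>2 * (sqrt u * log_plus T'))" using a by (intro mult_left_mono) auto
      then show ?thesis by (simp add: a_def mult_ac)
    qed
    have 3: "a * W \<le> x * c\<^sup>2 * (w * log_plus T' / T')"
    proof -
      have "w * 1 \<le> w * log_plus T'" using lp uw by (intro mult_left_mono) auto
      then have "c\<^sup>2 * w \<le> c\<^sup>2 * (w * log_plus T')" by (intro mult_left_mono) auto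
      then have "W \<le> c\<^sup>2 * (w * log_plus T')" using w by linarith
      then have "a * W \<le> a * (c\<^sup>2 * (w * log_plus T'))" using a by (intro mult_left_mono) auto
      then show ?thesis by (simp add: a_def mult_ac)
    qed
    have "real n / real N ^ 2 \<le> 8 * (x * c\<^sup>2 * (1 / T' powr (2 / 3)) +
        x * c\<^sup>2 * (sqrt u * log_plus T' / T') + x * c\<^sup>2 * (w * log_plus T' / T'))"
      by (rule order_trans[OF cost mult_left_mono]) (intro add_mono 1 2 3, simp)
    also have "\<dots> = 8 * (x * c\<^sup>2) * (1 / T' powr (2 / 3) + sqrt u * log_plus T' / T' + w * log_plus T' / T')"
      by (simp only: distrib_left mult.assoc)
    also have "8 * (x * c\<^sup>2) = 14336 * c\<^sup>2 / \<epsilon>\<^sup>2" by (simp add: x_def)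
    finally show ?thesis .
  qed
  then show ?thesis using that adm aeq by metis
qed

text \<open>The rates are computed from values raised to at least 1; these are comparable to the
  true maxima once the graph has a triangle, as it does when \<open>0 < T' \<le> T\<close>.\<close>

lemma triangles_nonempty_imp_max_ge_1:
  assumes "finite V" "E \<subseteq> vertex_pairs V" "num_triangles V E > 0"
  shows "max_vertex_triangles V E \<ge> 1" "max_edge_triangles V E \<ge> 1"
proof -
  note finE = finite_edges[OF assms(1,2)]
  obtain t where t: "t \<in> triangles V E" using assms(3) by (fastforce simp: num_triangles_def)
  then have "card t = 3" by (simp add: triangles_def)
  then obtain u v w where uvw: "t = {u, v, w}" "u \<noteq> v" by (auto simp: card_3_iff)
  have "u \<in> V" "{u, v} \<in> E" using t uvw by (auto simp: triangles_def)
  moreover have "card {s \<in> triangles V E. u \<in> s} > 0" "card {s \<in> triangles V E. {u, v} \<subseteq> s} > 0"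
    using t uvw finite_triangles[OF assms(1), of E] by (auto simp: card_gt_0_iff)
  ultimately show "max_vertex_triangles V E \<ge> 1" "max_edge_triangles V E \<ge> 1"
    using card_triangles_at_vertex_le[OF assms(1), of u E] card_triangles_at_edge_le[OF finE, of "{u, v}" V]
    by linarith+
qed

section \<open>Assembly into one sampling algorithm\<close>

text \<open>The algorithm is quantified before \<open>E\<close> and \<open>es\<close>, as
  nonadaptivity demands. For \<open>\<epsilon> \<ge> 1\<close> the constant answer 0 has error
  \<open>T \<le> \<epsilon> * T\<close> and keeps no edge.\<close>

lemma sampling_alg_exists:
  fixes V :: "'v set" and c \<epsilon> \<delta> T' DV DE :: real
  assumes c: "c \<ge> 1" and V: "finite V" and \<epsilon>: "\<epsilon> > 0" and \<delta>: "0 < \<delta>" "\<delta> < 1" and T': "T' > 0"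
  shows "\<exists>A. samples_pairs_of V A \<and>
       (\<forall>E es. simple_graph V E \<and> edge_stream E es \<and>
          known_within c (real (max_vertex_triangles V E)) DV \<and>
          known_within c (real (max_edge_triangles V E)) DE \<longrightarrow>
          measure_pmf.prob (output_dist A es) (acceptable \<epsilon> T' (real (num_triangles V E))) \<ge> 1 - \<delta> \<and>
          (T' \<le> real (num_triangles V E) \<longrightarrow> expected_samples A es
               \<le> 43008 * c\<^sup>2 * sample_bound (real (card E)) \<epsilon> \<delta> T'
                      (real (max_vertex_triangles V E)) (real (max_edge_triangles V E))))"
proof (cases "\<epsilon> \<ge> 1")
  case True
  have "T \<le> \<epsilon> * T" if "T \<ge> 0" for T using mult_right_mono[OF True that] by simp
  then have "Estimate 0 \<in> acceptable \<epsilon> T' T" if "T \<ge> 0" for T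
    using that by (auto simp: acceptable_def good_estimates_def)
  moreover have "0 \<le> sample_bound (real m) \<epsilon> \<delta> T' (real u) (real w)" for m u w
    using \<delta> T' by (auto simp: sample_bound_def log_plus_def intro!: mult_nonneg_nonneg add_nonneg_nonneg divide_nonneg_nonneg)
  ultimately show ?thesis
    using \<delta>
    by (intro exI[of _ "return_pmf ({}, \<lambda>_. Estimate 0)"])
       (auto simp: samples_pairs_of_def output_dist_def expected_samples_def kept_edges_eq indicator_def)
next
  case False
  then have \<epsilon>1: "\<epsilon> < 1" by simp
  \<comment> \<open>Multiplying the rough value by \<open>c\<close> gives a true upper bound, at
    most \<open>c\<^sup>2\<close> too large; the 1 meets the hypothesis \<open>U \<ge> 1\<close> on
    the rates.\<close>
  define U where "U = max 1 (c * DV)"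
  define W where "W = max 1 (c * DE)"
  obtain l k where l: "0 \<le> l" "l \<le> 1" "1 - \<delta> \<le> l * (1 - (1 / 2) ^ k)" "l * real k \<le> 3 * ln (1 / \<delta>)"
    using repetitions_exist[OF \<delta>] by blast
  have "U \<ge> 1" "W \<ge> 1" by (auto simp: U_def W_def)
  then obtain n N where adm: "admissible_rates (1792 / (\<epsilon>\<^sup>2 * T')) U W n N"
    and cost: "\<And>u w. U \<le> c\<^sup>2 * u \<Longrightarrow> W \<le> c\<^sup>2 * w \<Longrightarrow> real n / real N ^ 2 \<le> 14336 * c\<^sup>2 / \<epsilon>\<^sup>2 *
       (1 / T' powr (2 / 3) + sqrt u * log_plus T' / T' + w * log_plus T' / T')"
    using sampling_rates_exist[OF \<epsilon> \<epsilon>1 T' _ _ c] by metis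
  have N: "0 < N" "n \<le> N" using adm by (auto simp: admissible_rates_def)
  define A where "A = hybrid_alg V n N k ((1 - \<epsilon> / 4) * T')"
  have finA: "finite (set_pmf A)" unfolding A_def by (intro finite_set_pmf_hybrid_alg V N)
  have upper: "x \<le> max 1 (c * y)" if "known_within c x y" for x y
    using that c by (auto simp: known_within_def field_simps le_max_iff_disj)
  have lower: "max 1 (c * y) \<le> c\<^sup>2 * x" if "known_within c x y" "x \<ge> 1" for x y
  proof -
    have "c * y \<le> c * (c * x)" using that c by (intro mult_left_mono) (auto simp: known_within_def)
    moreover have "1 * 1 \<le> c\<^sup>2 * x" using that c by (intro mult_mono) auto
    ultimately show ?thesis by (simp add: power2_eq_square)
  qed
  show ?thesis
  proof (intro exI[of _ "thinned l A"] conjI allI impI)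
    show "samples_pairs_of V (thinned l A)"
      unfolding A_def by (intro samples_pairs_of_thinned samples_pairs_of_hybrid_alg)
  next
    fix E es
    let ?u = "real (max_vertex_triangles V E)" and ?w = "real (max_edge_triangles V E)"
    assume asm: "simple_graph V E \<and> edge_stream E es \<and> known_within c ?u DV \<and> known_within c ?w DE"
    then have E: "E \<subseteq> vertex_pairs V" and es: "edge_stream E es" by (auto simp: simple_graph_def)
    have UW: "?u \<le> U" "?w \<le> W" unfolding U_def W_def using asm by (auto intro!: upper)
    note l(3)
    also have "l * (1 - (1 / 2) ^ k) \<le> l * measure_pmf.prob (output_dist A es) (acceptable \<epsilon> T' (real (num_triangles V E)))"
      unfolding A_def
      by (intro mult_left_mono prob_hybrid_alg_acceptable[OF V E es UW \<epsilon> \<epsilon>1 T' adm] l)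
    also have "\<dots> \<le> measure_pmf.prob (output_dist (thinned l A) es) (acceptable \<epsilon> T' (real (num_triangles V E)))"
      by (intro prob_output_thinned_ge finA l)
    finally show "1 - \<delta> \<le> \<dots>" .
    assume "T' \<le> real (num_triangles V E)"
    then have "num_triangles V E > 0" using T' by simp
    then have "?u \<ge> 1" "?w \<ge> 1" using triangles_nonempty_imp_max_ge_1[OF V E] by simp_all
    then have UW2: "U \<le> c\<^sup>2 * ?u" "W \<le> c\<^sup>2 * ?w" 
      unfolding U_def W_def using asm by (blast intro: lower)+
    have "expected_samples (thinned l A) es = l * expected_samples A es"
      by (rule expected_samples_thinned[OF finA l(1,2) es])
    also have "\<dots> \<le> l * (real k * real (card E) * (real n / real N ^ 2))"
      unfolding A_def by (intro mult_left_mono expected_samples_hybrid_alg_le V E es N l)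
    also have "\<dots> = (l * real k) * (real (card E) * (real n / real N ^ 2))" by (simp add: mult_ac)
    \<comment> \<open>The factor 3 of \<open>repetitions_exist\<close> and the 14336 of the rates
      give \<open>43008\<close>.\<close>
    also have "\<dots> \<le> (3 * ln (1 / \<delta>)) * (real (card E) * (14336 * c\<^sup>2 / \<epsilon>\<^sup>2 *
       (1 / T' powr (2 / 3) + sqrt ?u * log_plus T' / T' + ?w * log_plus T' / T')))"
      using \<delta> by (intro mult_mono l mult_left_mono cost UW2) auto
    also have "\<dots> = 43008 * c\<^sup>2 * sample_bound (real (card E)) \<epsilon> \<delta> T' ?u ?w"
      by (simp add: sample_bound_def)
    finally show "expected_samples (thinned l A) es \<le> 43008 * c\<^sup>2 * sample_bound (real (card E)) \<epsilon> \<delta> T' ?u ?w" .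
  qed
qed

theorem mainTheorem1:
  fixes c :: real
  assumes "c \<ge> 1"
  shows "\<exists>(A :: nat set \<Rightarrow> real \<Rightarrow> real \<Rightarrow> real \<Rightarrow> real \<Rightarrow> real \<Rightarrow> nat sampling_alg) (C :: real).
    C > 0 \<and>
    (\<forall>V \<epsilon> \<delta> T' DV DE. finite V \<and> \<epsilon> > 0 \<and> 0 < \<delta> \<and> \<delta> < 1 \<and> T' > 0 \<longrightarrow>
       samples_pairs_of V (A V \<epsilon> \<delta> T' DV DE) \<and>
       (\<forall>E es. simple_graph V E \<and> edge_stream E es \<and>
          known_within c (real (max_vertex_triangles V E)) DV \<and>
          known_within c (real (max_edge_triangles V E)) DE \<longrightarrow>
          (T' \<le> real (num_triangles V E) \<longrightarrow>
             measure_pmf.prob (output_dist (A V \<epsilon> \<delta> T' DV DE) es)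
               (good_estimates \<epsilon> (real (num_triangles V E))) \<ge> 1 - \<delta> \<and>
             expected_samples (A V \<epsilon> \<delta> T' DV DE) es
               \<le> C * sample_bound (real (card E)) \<epsilon> \<delta> T'
                      (real (max_vertex_triangles V E)) (real (max_edge_triangles V E))) \<and>
          (T' > real (num_triangles V E) \<longrightarrow>
             measure_pmf.prob (output_dist (A V \<epsilon> \<delta> T' DV DE) es)
               ({Guess_Too_Large} \<union> good_estimates \<epsilon> (real (num_triangles V E))) \<ge> 1 - \<delta>)))"
proof -
  let ?good = "\<lambda>V \<epsilon> \<delta> T' DV DE (A :: nat sampling_alg). samples_pairs_of V A \<and>
       (\<forall>E es. simple_graph V E \<and> edge_stream E es \<and>
          known_within c (real (max_vertex_triangles V E)) DV \<and>
          known_within c (real (max_edge_triangles V E)) DE \<longrightarrow>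
          measure_pmf.prob (output_dist A es) (acceptable \<epsilon> T' (real (num_triangles V E))) \<ge> 1 - \<delta> \<and>
          (T' \<le> real (num_triangles V E) \<longrightarrow> expected_samples A es
               \<le> 43008 * c\<^sup>2 * sample_bound (real (card E)) \<epsilon> \<delta> T'
                      (real (max_vertex_triangles V E)) (real (max_edge_triangles V E))))"
  \<comment> \<open>Choice makes the algorithm a function of the vertex set and the parameters; the
    constant depends on \<open>c\<close> alone.\<close>
  define A where "A = (\<lambda>V \<epsilon> \<delta> T' DV DE. SOME A. ?good V \<epsilon> \<delta> T' DV DE A)"
  have A: "?good V \<epsilon> \<delta> T' DV DE (A V \<epsilon> \<delta> T' DV DE)"
    if "finite V \<and> \<epsilon> > 0 \<and> 0 < \<delta> \<and> \<delta> < 1 \<and> T' > 0" for V \<epsilon> \<delta> T' DV DE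
    unfolding A_def by (rule someI_ex, rule sampling_alg_exists) (use assms that in auto)
  have "43008 * c\<^sup>2 > 0" using assms by simp
  then show ?thesis
  proof (intro exI[of _ A] exI[of _ "43008 * c\<^sup>2"] conjI allI impI)
    fix V :: "nat set" and \<epsilon> \<delta> T' DV DE :: real
    assume par: "finite V \<and> \<epsilon> > 0 \<and> 0 < \<delta> \<and> \<delta> < 1 \<and> T' > 0"
    note G = A[OF par, of DV DE]
    show "samples_pairs_of V (A V \<epsilon> \<delta> T' DV DE)" using G by blast
    fix E es
    assume "simple_graph V E \<and> edge_stream E es \<and>
          known_within c (real (max_vertex_triangles V E)) DV \<and>
          known_within c (real (max_edge_triangles V E)) DE"
    then have G: "measure_pmf.prob (output_dist (A V \<epsilon> \<delta> T' DV DE) es) (acceptable \<epsilon> T' (real (num_triangles V E))) \<ge> 1 - \<delta>"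
      "T' \<le> real (num_triangles V E) \<longrightarrow> expected_samples (A V \<epsilon> \<delta> T' DV DE) es
               \<le> 43008 * c\<^sup>2 * sample_bound (real (card E)) \<epsilon> \<delta> T'
                      (real (max_vertex_triangles V E)) (real (max_edge_triangles V E))"
      using G by blast+
    show "measure_pmf.prob (output_dist (A V \<epsilon> \<delta> T' DV DE) es)
               (good_estimates \<epsilon> (real (num_triangles V E))) \<ge> 1 - \<delta>"
      if "T' \<le> real (num_triangles V E)"
      using G(1) that by (simp add: acceptable_def)
    show "expected_samples (A V \<epsilon> \<delta> T' DV DE) es
               \<le> 43008 * c\<^sup>2 * sample_bound (real (card E)) \<epsilon> \<delta> T'
                      (real (max_vertex_triangles V E)) (real (max_edge_triangles V E))"
      if "T' \<le> real (num_triangles V E)"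
      using G(2) that by blast
    show "measure_pmf.prob (output_dist (A V \<epsilon> \<delta> T' DV DE) es)
               ({Guess_Too_Large} \<union> good_estimates \<epsilon> (real (num_triangles V E))) \<ge> 1 - \<delta>"
      if "T' > real (num_triangles V E)"
      using G(1) that by (simp add: acceptable_def)
  qed
qed

end
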